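(* Let $G=(V,E)$ be a finite decomposable graph and $\mathcal G$ any moral DAG with skeleton $G$. Then the Bayesian models generated by 1) $\mathbb P_{N\mid X}=\operatorname{nm}_G(r,X)$ and $\mathbb P_X=\operatorname{Dir}_G(\alpha,\beta)$ (with $r>0$, $\alpha\in(0,\infty)^V$, $\beta>0$), and 2) $\mathbb P_{N\mid Y}=\operatorname{mult}_G(r,Y)$ and $\mathbb P_Y=\operatorname{IDir}_G(\alpha,\beta)$ (with $r\in\{1,2,\ldots\}$, $\alpha\in(0,\infty)^V$, $\beta>\max_{C\in\mathcal C_G^+}\sum_{i\in C}\alpha_i$), are strong directed hyper Markov over $\mathcal G$; that is, in each model, for all $i\in V$, the families of random variables $p_{\{i\}\mid\mathfrak{pa}(i)}$ and $p_{\mathfrak{nde}(i)}$ are independent.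
   Context: $\mathbb N=\{0,1,2,\ldots\}$. $G=(V,E)$ is a finite undirected simple graph; $G^*$ its complement graph; $G_A$ the subgraph induced by $A\subset V$. A clique is a set of pairwise adjacent vertices ($\emptyset$ and singletons are cliques); $\mathcal C_G$ is the set of cliques and $\mathcal C_G^+$ the set of maximal cliques. $G$ is decomposable iff it is chordal (no induced cycle of length greater than 3). A moral DAG $\mathcal G$ with skeleton $G$ is an orientation of all edges of $G$ without directed cycles such that any two distinct parents of a common vertex are adjacent. $\mathfrak{pa}(i)=\{j:j\to i\}$; $\mathfrak{nde}(i)=V\setminus(\mathfrak{de}(i)\cup\{i\})$, where $\mathfrak{de}(i)$ is the set of vertices reachable from $i$ by a directed path of length at least 1. $\Delta_G(x)=\sum_{C\in\mathcal C_{G^*}}(-1)^{|C|}\prod_{i\in C}x_i$, $\delta_G(y)=\sum_{C\in\mathcal C_{G^*}}\prod_{i\in C}y_i$; for $A\subset V$, $\Delta_A(x):=\Delta_{G_A}(x_A)$, $\Delta_\emptyset=1$; $M_G=\{x\in(0,\infty)^V:\Delta_A(x)>0\ \forall A\subset V\}$. $x_A=(x_i)_{i\in A}$, $x^n=\prod_{i\in V}x_i^{n_i}$, $|n_A|=\sum_{i\in A}n_i$, $|n|=|n_V|$. For an integer $r\ge1$, $\binom{r}{n}_G$ is defined by $\delta_G(y)^r=\sum_{n\in\mathbb N^V}\binom{r}{n}_G y^n$; for real $r>0$, $\genfrac{[}{]}{0pt}{}{|n|+r-1}{n}_G$ is defined by the formal power series $\Delta_G(x)^{-r}=\sum_{n\in\mathbb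 N^V}\genfrac{[}{]}{0pt}{}{|n|+r-1}{n}_G x^n$. $\operatorname{nm}_G(r,x)$ ($x\in M_G$): $\mathbb P(N=n)=\genfrac{[}{]}{0pt}{}{|n|+r-1}{n}_G\,x^n\Delta_G(x)^r$, $n\in\mathbb N^V$. $\operatorname{mult}_G(r,y)$ ($y\in(0,\infty)^V$): $\mathbb P(N=n)=\binom{r}{n}_G\,y^n\delta_G(y)^{-r}$, $n\in\mathbb N_{G,r}:=\{n\in\mathbb N^V:\max_{C\in\mathcal C_G^+}|n_C|\le r\}$. $\operatorname{Dir}_G(\alpha,\beta)$ has Lebesgue density proportional to $\Delta_G(x)^{\beta-1}\prod_i x_i^{\alpha_i-1}\mathbf 1_{M_G}(x)$, and $\operatorname{IDir}_G(\alpha,\beta)$ has density proportional to $\delta_G(y)^{-\beta}\prod_i y_i^{\alpha_i-1}\mathbf 1_{(0,\infty)^V}(y)$. Families of random variables: with $X$ denoting the random parameter ($Y$ in the second model), for $A,B\subset V$, $$p_A=\big(\mathbb P(N_A=n_A\mid X)\big)_{n_A\in\mathbb N^A},\qquad p_{B\mid A}=\left(\frac{\mathbb P(N_{A\cup B}=n_{A\cup B}\mid X)}{\mathbb P(N_A=n_A\mid X)}\right)_{n_{A\cup B}\in\mathbb N^{A\cup B}}$$ (in the multinomial case the index $n_{A\cup B}$ is restricted to those for which the denominator is nonzero, a condition not depending on the value of the parameter). Each is a collection of random variables which are functions of the parameter. *)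

theory Defs
  imports "HOL-Probability.Probability" "HOL-Library.Poly_Mapping"
begin

section \<open>Graphs\<close>

text \<open>
  A finite simple graph is given by its vertex set and its adjacency relation.
  Vectors indexed by \<open>A \<subseteq> V\<close> are extensional functions, i.e. elements of \<open>\<Pi>\<^sub>E i\<in>A. UNIV\<close>.
\<close>

definition finite_simple_graph :: "'a set \<Rightarrow> 'a rel \<Rightarrow> bool" where
  "finite_simple_graph V E \<longleftrightarrow> finite V \<and> E \<subseteq> V \<times> V \<and> sym E \<and> irrefl E"

definition complement_graph :: "'a set \<Rightarrow> 'a rel \<Rightarrow> 'a rel" where
  "complement_graph V E = {(i, j) \<in> V \<times> V. i \<noteq> j \<and> (i, j) \<notin> E}"

definition induced :: "'a rel \<Rightarrow> 'a set \<Rightarrow> 'a rel" where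
  "induced E A = E \<inter> A \<times> A"

definition cliques :: "'a set \<Rightarrow> 'a rel \<Rightarrow> 'a set set" where
  "cliques V E = {C. C \<subseteq> V \<and> (\<forall>i\<in>C. \<forall>j\<in>C. i \<noteq> j \<longrightarrow> (i, j) \<in> E)}"

definition max_cliques :: "'a set \<Rightarrow> 'a rel \<Rightarrow> 'a set set" where
  "max_cliques V E = {C \<in> cliques V E. \<forall>C' \<in> cliques V E. C \<subseteq> C' \<longrightarrow> C' = C}"

definition induced_cycle :: "'a set \<Rightarrow> 'a rel \<Rightarrow> 'a list \<Rightarrow> bool" where
  "induced_cycle V E c \<longleftrightarrow> length c \<ge> 3 \<and> distinct c \<and> set c \<subseteq> V \<and>
     (\<forall>a b. a < b \<and> b < length c \<longrightarrow>
        ((c ! a, c ! b) \<in> E \<longleftrightarrow> b = Suc a \<or> (a = 0 \<and> b = length c - 1)))"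

definition decomposable :: "'a set \<Rightarrow> 'a rel \<Rightarrow> bool" where
  "decomposable V E \<longleftrightarrow> \<not> (\<exists>c. induced_cycle V E c \<and> length c > 3)"

text \<open>In a directed graph \<open>D\<close>, a pair \<open>(j, i) \<in> D\<close> is an arrow \<open>j \<rightarrow> i\<close>.\<close>

definition orientation :: "'a rel \<Rightarrow> 'a rel \<Rightarrow> bool" where
  "orientation E D \<longleftrightarrow> D \<union> D\<inverse> = E \<and> asym D"

definition parents :: "'a rel \<Rightarrow> 'a \<Rightarrow> 'a set" where
  "parents D i = {j. (j, i) \<in> D}"

definition descendants :: "'a rel \<Rightarrow> 'a \<Rightarrow> 'a set" where
  "descendants D i = {j. (i, j) \<in> D\<^sup>+}"

definition nondescendants :: "'a set \<Rightarrow> 'a rel \<Rightarrow> 'a \<Rightarrow> 'a set" where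
  "nondescendants V D i = V - (descendants D i \<union> {i})"

definition moral_DAG :: "'a rel \<Rightarrow> 'a rel \<Rightarrow> bool" where
  "moral_DAG E D \<longleftrightarrow> orientation E D \<and> acyclic D \<and>
     (\<forall>i. \<forall>j\<in>parents D i. \<forall>k\<in>parents D i. j \<noteq> k \<longrightarrow> (j, k) \<in> E)"


section \<open>The graph polynomials and their powers\<close>

text \<open>
  Both polynomials are stated over an arbitrary commutative ring: over \<^typ>\<open>real\<close> they are
  the polynomial functions, and evaluated at the indeterminates of the polynomial ring
  \<^typ>\<open>('a \<Rightarrow>\<^sub>0 nat) \<Rightarrow>\<^sub>0 real\<close> they are the formal polynomials.
\<close>

definition Delta :: "'a set \<Rightarrow> 'a rel \<Rightarrow> ('a \<Rightarrow> 'b::comm_ring_1) \<Rightarrow> 'b" where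
  "Delta V E x = (\<Sum>C\<in>cliques V (complement_graph V E). (- 1) ^ card C * (\<Prod>i\<in>C. x i))"

definition delta :: "'a set \<Rightarrow> 'a rel \<Rightarrow> ('a \<Rightarrow> 'b::comm_ring_1) \<Rightarrow> 'b" where
  "delta V E y = (\<Sum>C\<in>cliques V (complement_graph V E). \<Prod>i\<in>C. y i)"

definition indet :: "'a \<Rightarrow> (('a \<Rightarrow>\<^sub>0 nat) \<Rightarrow>\<^sub>0 real)" where
  "indet i = Poly_Mapping.single (Poly_Mapping.single i 1) 1"

definition exponent :: "'a set \<Rightarrow> ('a \<Rightarrow> nat) \<Rightarrow> ('a \<Rightarrow>\<^sub>0 nat)" where
  "exponent V n = (\<Sum>i\<in>V. Poly_Mapping.single i (n i))"

definition mult_coeff :: "'a set \<Rightarrow> 'a rel \<Rightarrow> nat \<Rightarrow> ('a \<Rightarrow> nat) \<Rightarrow> real" where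
  "mult_coeff V E r n = Poly_Mapping.lookup (delta V E indet ^ r) (exponent V n)"

text \<open>
  The power series \<open>Delta\<^sup>-\<^sup>r\<close> is the binomial series \<open>\<Sum>k. (- r gchoose k) * (Delta - 1) ^ k\<close>,
  which makes sense formally since \<open>Delta - 1\<close> has no constant term. For the same reason only
  the terms with \<open>k \<le> |n|\<close> contribute to the coefficient at \<open>n\<close>; see
  \<open>lookup_Delta_minus_1_power\<close> below.
\<close>

definition nm_coeff :: "'a set \<Rightarrow> 'a rel \<Rightarrow> real \<Rightarrow> ('a \<Rightarrow> nat) \<Rightarrow> real" where
  "nm_coeff V E r n =
     (\<Sum>k\<le>(\<Sum>i\<in>V. n i). (- r gchoose k) *
        Poly_Mapping.lookup ((Delta V E indet - 1) ^ k) (exponent V n))"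

lemma prod_indet: "finite C \<Longrightarrow> (\<Prod>i\<in>C. indet i) = Poly_Mapping.single (exponent C (\<lambda>_. 1)) 1"
  by (induction C rule: finite_induct)
     (simp_all add: indet_def exponent_def Poly_Mapping.mult_single flip: one_poly_mapping_def
        Poly_Mapping.single_one)

lemma lookup_exponent:
  assumes "finite V"
  shows "Poly_Mapping.lookup (exponent V n) i = (if i \<in> V then n i else 0)"
  using assms unfolding exponent_def
  by (induction V rule: finite_induct) (auto simp: lookup_add lookup_single when_def)

lemma lookup_Delta_minus_1_power:
  assumes "finite V" "k > (\<Sum>i\<in>V. n i)"
  shows "Poly_Mapping.lookup ((Delta V E indet - 1) ^ k) (exponent V n) = 0"
proof -
  define deg :: "('a \<Rightarrow>\<^sub>0 nat) \<Rightarrow> nat" where "deg m = (\<Sum>i\<in>V. Poly_Mapping.lookup m i)" for m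
  define p where "p = Delta V E (indet :: 'a \<Rightarrow> _) - 1"
  let ?K = "cliques V (complement_graph V E)"
  have K: "finite ?K" "{} \<in> ?K"
    using assms(1) by (auto simp: cliques_def)
  have "p = (\<Sum>C\<in>?K - {{}}. (- 1) ^ card C * (\<Prod>i\<in>C. indet i))"
    unfolding p_def Delta_def by (subst sum.remove[OF K]) simp
  also have "Poly_Mapping.keys \<dots> \<subseteq> (\<Union>C\<in>?K - {{}}. {exponent C (\<lambda>_. 1)})"
  proof (rule order_trans[OF keys_sum], rule UN_mono)
    fix C assume "C \<in> ?K - {{}}"
    then have C: "finite C" using assms(1) by (auto simp: cliques_def dest: finite_subset)
    have "Poly_Mapping.keys ((- 1) ^ card C * q) = Poly_Mapping.keys q"
      for q :: "('a \<Rightarrow>\<^sub>0 nat) \<Rightarrow>\<^sub>0 real"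
      by (cases "even (card C)") auto
    then show "Poly_Mapping.keys ((- 1) ^ card C * (\<Prod>i\<in>C. indet i)) \<subseteq> {exponent C (\<lambda>_. 1)}"
      by (simp add: prod_indet[OF C])
  qed simp
  finally have keys: "Poly_Mapping.keys p \<subseteq> (\<Union>C\<in>?K - {{}}. {exponent C (\<lambda>_. 1)})" .
  have p: "deg m \<ge> 1" if m: "m \<in> Poly_Mapping.keys p" for m
  proof -
    from keys m obtain C where C: "C \<in> ?K" "C \<noteq> {}" "m = exponent C (\<lambda>_. 1)"
      by blast
    then obtain i where i: "i \<in> C" "i \<in> V" "finite C"
      using assms(1) by (auto simp: cliques_def dest: finite_subset)
    then have "Poly_Mapping.lookup m i \<le> deg m"
      unfolding deg_def using assms(1) by (intro member_le_sum) auto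
    then show ?thesis using i C by (simp add: lookup_exponent)
  qed
  have "deg m \<ge> k" if "m \<in> Poly_Mapping.keys (p ^ k)" for m k
    using that
  proof (induction k arbitrary: m)
    case (Suc k)
    then have "m \<in> Poly_Mapping.keys (p * p ^ k)" by simp
    then obtain a b where "m = a + b" "a \<in> Poly_Mapping.keys p" "b \<in> Poly_Mapping.keys (p ^ k)"
      using keys_mult by blast
    then show ?case
      using p[of a] Suc.IH[of b] by (simp add: deg_def lookup_add sum.distrib)
  qed simp
  moreover have "deg (exponent V n) = (\<Sum>i\<in>V. n i)"
    using assms(1) by (simp add: deg_def lookup_exponent)
  ultimately have "exponent V n \<notin> Poly_Mapping.keys (p ^ k)"
    using assms(2) by fastforce
  then show ?thesis
    by (simp add: p_def in_keys_iff)
qed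


section \<open>The distributions\<close>

definition M_set :: "'a set \<Rightarrow> 'a rel \<Rightarrow> ('a \<Rightarrow> real) set" where
  "M_set V E = {x \<in> V \<rightarrow>\<^sub>E {0<..}. \<forall>A\<subseteq>V. Delta A (induced E A) x > 0}"

definition nm :: "'a set \<Rightarrow> 'a rel \<Rightarrow> real \<Rightarrow> ('a \<Rightarrow> real) \<Rightarrow> ('a \<Rightarrow> nat) measure" where
  "nm V E r x = density (count_space (V \<rightarrow>\<^sub>E UNIV))
     (\<lambda>n. ennreal (nm_coeff V E r n * (\<Prod>i\<in>V. x i ^ n i) * Delta V E x powr r))"

definition mult_support :: "'a set \<Rightarrow> 'a rel \<Rightarrow> nat \<Rightarrow> ('a \<Rightarrow> nat) set" where
  "mult_support V E r = {n \<in> V \<rightarrow>\<^sub>E UNIV. Max ((\<lambda>C. \<Sum>i\<in>C. n i) ` max_cliques V E) \<le> r}"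

definition multinomial :: "'a set \<Rightarrow> 'a rel \<Rightarrow> nat \<Rightarrow> ('a \<Rightarrow> real) \<Rightarrow> ('a \<Rightarrow> nat) measure" where
  "multinomial V E r y = density (count_space (V \<rightarrow>\<^sub>E UNIV))
     (\<lambda>n. ennreal (mult_coeff V E r n * (\<Prod>i\<in>V. y i ^ n i) / delta V E y ^ r
                   * indicator (mult_support V E r) n))"

definition prob_density :: "'b measure \<Rightarrow> ('b \<Rightarrow> real) \<Rightarrow> 'b measure" where
  "prob_density L f = density L (\<lambda>x. ennreal (f x) / (\<integral>\<^sup>+ z. ennreal (f z) \<partial>L))"

definition Dir :: "'a set \<Rightarrow> 'a rel \<Rightarrow> ('a \<Rightarrow> real) \<Rightarrow> real \<Rightarrow> ('a \<Rightarrow> real) measure" where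
  "Dir V E \<alpha> \<beta> = prob_density (\<Pi>\<^sub>M i\<in>V. lborel)
     (\<lambda>x. Delta V E x powr (\<beta> - 1) * (\<Prod>i\<in>V. x i powr (\<alpha> i - 1)) * indicator (M_set V E) x)"

definition IDir :: "'a set \<Rightarrow> 'a rel \<Rightarrow> ('a \<Rightarrow> real) \<Rightarrow> real \<Rightarrow> ('a \<Rightarrow> real) measure" where
  "IDir V E \<alpha> \<beta> = prob_density (\<Pi>\<^sub>M i\<in>V. lborel)
     (\<lambda>y. delta V E y powr (- \<beta>) * (\<Prod>i\<in>V. y i powr (\<alpha> i - 1))
            * indicator (V \<rightarrow>\<^sub>E {0<..}) y)"


section \<open>Bayesian models and the strong directed hyper Markov property\<close>

text \<open>
  A model consists of a parameter set \<open>\<Theta>\<close>, the law \<open>P\<close> of the random parameter and, for each value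
  \<open>x\<close> of the parameter, the law \<open>K x\<close> of \<open>N\<close> given that value. The random parameter is realised
  as the identity on the probability space \<open>P\<close>, so that a function of the parameter is a random
  variable on \<open>P\<close>.

  Being a model includes that \<open>P\<close> and \<open>K x\<close> have total mass 1: the constructions above always
  yield some measure, even when a normalising constant is infinite.
\<close>

definition bayesian_model ::
    "'t set \<Rightarrow> 't measure \<Rightarrow> ('t \<Rightarrow> ('a \<Rightarrow> nat) measure) \<Rightarrow> bool" where
  "bayesian_model \<Theta> P K \<longleftrightarrow>
     prob_space P \<and> (AE x in P. x \<in> \<Theta>) \<and> (\<forall>x\<in>\<Theta>. prob_space (K x))"

text \<open>\<open>marginal_prob Q A n\<close> is the probability that \<open>N\<^sub>A = n\<^sub>A\<close> when \<open>N\<close> has law \<open>Q\<close>.\<close>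

definition marginal_prob :: "('a \<Rightarrow> nat) measure \<Rightarrow> 'a set \<Rightarrow> ('a \<Rightarrow> nat) \<Rightarrow> real" where
  "marginal_prob Q A n = measure Q {m \<in> space Q. restrict m A = restrict n A}"

definition p_marg_index :: "'a set \<Rightarrow> ('a \<Rightarrow> nat) set" where
  "p_marg_index A = A \<rightarrow>\<^sub>E UNIV"

definition p_marg :: "('t \<Rightarrow> ('a \<Rightarrow> nat) measure) \<Rightarrow> 'a set \<Rightarrow> 't \<Rightarrow> ('a \<Rightarrow> nat) \<Rightarrow> real" where
  "p_marg K A x = (\<lambda>n\<in>p_marg_index A. marginal_prob (K x) A n)"

text \<open>
  In the models considered here, whether the denominator vanishes does not depend on the parameter
  in \<open>\<Theta>\<close>, so it does not matter whether \<open>x\<close> is quantified existentially or universally.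
\<close>

definition p_cond_index ::
    "'t set \<Rightarrow> ('t \<Rightarrow> ('a \<Rightarrow> nat) measure) \<Rightarrow> 'a set \<Rightarrow> 'a set \<Rightarrow> ('a \<Rightarrow> nat) set" where
  "p_cond_index \<Theta> K B A = {n \<in> (A \<union> B) \<rightarrow>\<^sub>E UNIV. \<exists>x\<in>\<Theta>. marginal_prob (K x) A n \<noteq> 0}"

definition p_cond ::
    "'t set \<Rightarrow> ('t \<Rightarrow> ('a \<Rightarrow> nat) measure) \<Rightarrow> 'a set \<Rightarrow> 'a set \<Rightarrow> 't \<Rightarrow> ('a \<Rightarrow> nat) \<Rightarrow> real" where
  "p_cond \<Theta> K B A x =
     (\<lambda>n\<in>p_cond_index \<Theta> K B A. marginal_prob (K x) (A \<union> B) n / marginal_prob (K x) A n)"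

definition strong_directed_hyper_Markov ::
    "'a set \<Rightarrow> 'a rel \<Rightarrow> 't set \<Rightarrow> 't measure \<Rightarrow> ('t \<Rightarrow> ('a \<Rightarrow> nat) measure) \<Rightarrow> bool" where
  "strong_directed_hyper_Markov V D \<Theta> P K \<longleftrightarrow>
     (\<forall>i\<in>V. prob_space.indep_var P
        (\<Pi>\<^sub>M n\<in>p_cond_index \<Theta> K {i} (parents D i). borel) (p_cond \<Theta> K {i} (parents D i))
        (\<Pi>\<^sub>M n\<in>p_marg_index (nondescendants V D i). borel) (p_marg K (nondescendants V D i)))"

end

theory Submission
  imports Defs
begin

text \<open>
  The two models are the two values of a sign \<open>s\<close>. Let \<open>P\<^sub>A(x)\<close> be the sum of
  \<open>s ^ card C * (\<Prod>i\<in>C. x i)\<close> over the stable sets \<open>C \<subseteq> A\<close>, so that \<open>Delta\<close> and \<open>delta\<close> are \<open>P\<^sub>V\<close> for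
  \<open>s = - 1\<close> and \<open>s = 1\<close>. In both models the probability of \<open>n\<close> is \<open>c\<^sub>n x^n P\<^sub>V(x) powr (- \<rho>)\<close>, where \<open>c\<^sub>n\<close> is
  the coefficient of \<open>x^n\<close> in the \<open>\<rho>\<close>-th power of \<open>P\<^sub>V\<close> (\<open>\<rho> = - r\<close> and \<open>\<rho> = r\<close>), and the prior
  has a density proportional to \<open>P\<^sub>V(x) powr \<gamma> * (\<Prod>i. x i powr (\<alpha> i - 1))\<close> on the set of positive \<open>x\<close> at
  which all \<open>P\<^sub>S\<close> are positive (\<open>\<gamma> = \<beta> - 1\<close> and \<open>\<gamma> = - \<beta>\<close>). The locale \<open>graph_model\<close> treats both at once.

  The proof eliminates the vertices one by one, always a sink \<open>i\<close> of what is left. Let \<open>A = insert i B\<close>.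
  The neighbours of \<open>i\<close> in \<open>B\<close> are its parents and form a clique. Put \<open>u = x i\<close> and let \<open>x'\<close> be \<open>x\<close> on \<open>B\<close>,
  with the coordinates of the parents of \<open>i\<close> divided by \<open>1 + s * u\<close>. As a stable set contains at most one
  parent, \<open>P\<^sub>A(x) = (1 + s * u) * P\<^sub>B(x')\<close> (lemma \<open>stable_poly_eliminate\<close>). This has two consequences.

  \<^item> If \<open>N\<close> follows the model on \<open>A\<close> with parameter \<open>x\<close>, then \<open>N\<^sub>B\<close> follows the model on \<open>B\<close> with parameter
    \<open>x'\<close>, and the distribution of \<open>N\<^sub>i\<close> given \<open>N\<^sub>B\<close> depends only on \<open>u\<close> and on the counts of the
    parents of \<open>i\<close> (lemmas \<open>marginal_law_eliminate\<close> and \<open>marginal_law_family\<close>).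
  \<^item> Under the prior on \<open>A\<close>, the variables \<open>u\<close> and \<open>x'\<close> are independent, \<open>u\<close> has a beta distribution (of the
    first or second kind), and the law of \<open>x'\<close> is the prior on \<open>B\<close> (lemma \<open>distr_prior_eliminate\<close>).

  For a given vertex \<open>i\<close>, eliminate first its descendants and then \<open>i\<close> itself. The conditional
  probabilities of \<open>N\<^sub>i\<close> given the parents become functions of \<open>u\<close>, and those of the
  nondescendants functions of \<open>x'\<close>; hence the two families are independent.

  The first consequence needs \<open>c\<^sub>n\<close> explicitly: it is the product over \<open>i\<close> of
  \<open>s ^ n i * ((\<rho> - q\<^sub>i) gchoose n i)\<close>, where \<open>q\<^sub>i\<close> is the total count of the parents of \<open>i\<close>. If \<open>\<rho>\<close> is a natural
  number \<open>m\<close>, then up to sign \<open>c\<^sub>n\<close> counts the lists of \<open>m\<close> stable sets containing each vertex \<open>i\<close> exactly \<open>n i\<close>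
  times. Place the vertices in an order compatible with the arrows: \<open>i\<close> has to avoid precisely the \<open>q\<^sub>i\<close>
  positions taken by its parents, which are pairwise distinct since parents are adjacent (lemma
  \<open>card_arrangements\<close>). For other \<open>\<rho>\<close> the formula follows since both sides are polynomials in \<open>\<rho>\<close> (lemma
  \<open>nm_coeff_eq\<close>).
\<close>


section \<open>Stable sets and their generating polynomial\<close>

definition stable_sets :: "'a rel \<Rightarrow> 'a set \<Rightarrow> 'a set set" where
  "stable_sets E A = {C. C \<subseteq> A \<and> (\<forall>i\<in>C. \<forall>j\<in>C. (i, j) \<notin> E)}"

text \<open>The independence polynomial of the graph induced by \<open>A\<close>, in its alternating form for \<open>s = - 1\<close>.
  The ring is left open so that it also covers the formal polynomials behind \<^const>\<open>nm_coeff\<close> and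
  \<^const>\<open>mult_coeff\<close>.\<close>
definition stable_poly :: "'b::comm_ring_1 \<Rightarrow> 'a rel \<Rightarrow> 'a set \<Rightarrow> ('a \<Rightarrow> 'b) \<Rightarrow> 'b" where
  "stable_poly s E A x = (\<Sum>C\<in>stable_sets E A. s ^ card C * (\<Prod>i\<in>C. x i))"

lemma cliques_complement_graph:
  "irrefl E \<Longrightarrow> cliques A (complement_graph A E) = stable_sets E A"
  by (auto simp: cliques_def complement_graph_def stable_sets_def irrefl_def subset_eq) metis

lemma cliques_complement_induced:
  "irrefl E \<Longrightarrow> cliques A (complement_graph A (induced E A)) = stable_sets E A"
  by (auto simp: cliques_def complement_graph_def stable_sets_def irrefl_def induced_def subset_eq) metis

lemma finite_stable_sets: "finite A \<Longrightarrow> finite (stable_sets E A)"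
  by (rule finite_subset[of _ "Pow A"]) (auto simp: stable_sets_def)

lemma stable_poly_cong: "(\<And>j. j \<in> A \<Longrightarrow> x j = y j) \<Longrightarrow> stable_poly s E A x = stable_poly s E A y"
  unfolding stable_poly_def by (intro sum.cong prod.cong arg_cong2[of _ _ _ _ "(*)"] refl) (auto simp: stable_sets_def)

lemma stable_sets_empty: "stable_sets E {} = {{}}"
  by (auto simp: stable_sets_def)

lemma stable_poly_empty: "stable_poly s E {} x = 1"
  by (simp add: stable_poly_def stable_sets_empty)

lemma stable_poly_pos:
  fixes x :: "'a \<Rightarrow> real"
  assumes "finite A" "\<And>j. j \<in> A \<Longrightarrow> x j > 0"
  shows "stable_poly 1 E A x > 0"
proof -
  have "{} \<in> stable_sets E A" by (simp add: stable_sets_def)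
  then show ?thesis
    unfolding stable_poly_def using assms
    by (intro sum_pos finite_stable_sets) (auto simp: stable_sets_def intro!: prod_pos)
qed

text \<open>
  Sort the stable sets by whether they contain \<open>i\<close>: those that do consist of \<open>i\<close> and a stable
  set avoiding the neighbours of \<open>i\<close>.
\<close>
lemma stable_poly_insert:
  assumes "finite A" "i \<notin> A" "sym E" "irrefl E"
  shows "stable_poly s E (insert i A) x =
    stable_poly s E A x + s * x i * stable_poly s E (A - {j. (j, i) \<in> E}) x"
proof -
  let ?R = "stable_sets E (A - {j. (j, i) \<in> E})"
  have split: "stable_sets E (insert i A) = stable_sets E A \<union> insert i ` ?R"
  proof (intro equalityI subsetI)
    fix C assume C: "C \<in> stable_sets E (insert i A)"
    show "C \<in> stable_sets E A \<union> insert i ` ?R"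
    proof (cases "i \<in> C")
      case True
      then have "C - {i} \<in> ?R" "C = insert i (C - {i})"
        using C by (auto simp: stable_sets_def)
      then show ?thesis by blast
    qed (use C in \<open>auto simp: stable_sets_def\<close>)
  next
    fix C assume C: "C \<in> stable_sets E A \<union> insert i ` ?R"
    show "C \<in> stable_sets E (insert i A)"
    proof (cases "C \<in> stable_sets E A")
      case False
      then obtain R where R: "C = insert i R" "R \<in> ?R" using C by blast
      have "(i, i) \<notin> E" using assms(4) by (simp add: irrefl_def)
      moreover have "(j, i) \<notin> E" "(i, j) \<notin> E" if "j \<in> R" for j
        using R that symD[OF assms(3), of i j] by (auto simp: stable_sets_def)
      ultimately show ?thesis
        using R by (auto simp: stable_sets_def)
    qed (auto simp: stable_sets_def)
  qed
  have inj: "inj_on (insert i) ?R"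
    using assms(2) by (auto simp: inj_on_def stable_sets_def)
  have disj: "stable_sets E A \<inter> insert i ` ?R = {}"
    using assms(2) by (auto simp: stable_sets_def)
  have "s ^ card (insert i C) * prod x (insert i C) = s * x i * (s ^ card C * prod x C)"
    if "C \<in> ?R" for C
  proof -
    have "finite C" "i \<notin> C"
      using that assms by (auto simp: stable_sets_def intro: finite_subset)
    then show ?thesis by (simp add: ac_simps)
  qed
  then show ?thesis
    unfolding stable_poly_def split using assms inj disj
    by (simp add: sum.union_disjoint finite_stable_sets sum.reindex sum_distrib_left)
qed

text \<open>A stable set meets a clique in at most one vertex, so \<open>stable_poly\<close> is affine in the
  variables of a clique.\<close>
lemma stable_poly_scale_clique:
  assumes "finite A" and Q: "\<And>i j. i \<in> Q \<Longrightarrow> j \<in> Q \<Longrightarrow> i \<noteq> j \<Longrightarrow> (i, j) \<in> E"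
  shows "stable_poly s E A (\<lambda>j. if j \<in> Q then t * x j else x j) =
    stable_poly s E (A - Q) x + t * (stable_poly s E A x - stable_poly s E (A - Q) x)"
proof -
  let ?y = "\<lambda>j. if j \<in> Q then t * x j else x j"
  let ?R = "stable_sets E A - stable_sets E (A - Q)"
  have sub: "stable_sets E (A - Q) \<subseteq> stable_sets E A"
    by (auto simp: stable_sets_def)
  have split: "stable_poly s E A z =
      stable_poly s E (A - Q) z + (\<Sum>C\<in>?R. s ^ card C * (\<Prod>i\<in>C. z i))" for z
    unfolding stable_poly_def using sum.subset_diff[OF sub finite_stable_sets[OF assms(1)]]
    by (simp add: add.commute)
  have "s ^ card C * prod ?y C = t * (s ^ card C * prod x C)" if "C \<in> ?R" for C
  proof -
    from that obtain q where q: "q \<in> C" "q \<in> Q"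
      by (auto simp: stable_sets_def)
    have fin: "finite C" using that assms(1) by (auto simp: stable_sets_def intro: finite_subset)
    have "j \<notin> Q" if "j \<in> C - {q}" for j
      using that \<open>C \<in> ?R\<close> q Q[of q j] by (auto simp: stable_sets_def)
    then have "prod ?y (C - {q}) = prod x (C - {q})"
      by (intro prod.cong) auto
    then show ?thesis
      using q fin by (simp add: prod.remove[of C q] ac_simps)
  qed
  moreover have "stable_poly s E (A - Q) ?y = stable_poly s E (A - Q) x"
    by (rule stable_poly_cong) auto
  ultimately show ?thesis
    unfolding split[of x] split[of ?y] by (simp add: sum_distrib_left)
qed


section \<open>Moral DAGs and ancestral sets\<close>

locale moral_graph =
  fixes V :: "'a set" and E D :: "'a rel"
  assumes graph: "finite_simple_graph V E" and moral: "moral_DAG E D"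
begin

lemma finite_V: "finite V" and E_sub: "E \<subseteq> V \<times> V" and sym_E: "sym E" and irrefl_E: "irrefl E"
  using graph by (auto simp: finite_simple_graph_def)

lemma acyclic_D: "acyclic D" and D_E: "D \<union> D\<inverse> = E"
  using moral by (auto simp: moral_DAG_def orientation_def)

lemma parents_clique: "j \<in> parents D i \<Longrightarrow> k \<in> parents D i \<Longrightarrow> j \<noteq> k \<Longrightarrow> (j, k) \<in> E"
  using moral by (auto simp: moral_DAG_def)

lemma parents_V: "parents D i \<subseteq> V"
  using D_E E_sub by (auto simp: parents_def)

lemma not_parent_self: "i \<notin> parents D i"
  using acyclic_D by (auto simp: parents_def acyclic_def)

lemma finite_parents: "finite (parents D i)"
  using parents_V finite_V by (rule finite_subset)

text \<open>A vertex has the same parents in the subgraph induced by an ancestral set as in the whole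
  graph, so that statements about ancestral sets can refer to \<^const>\<open>parents\<close> of \<open>D\<close>.\<close>
definition ancestral :: "'a set \<Rightarrow> bool" where
  "ancestral A \<longleftrightarrow> A \<subseteq> V \<and> (\<forall>i\<in>A. parents D i \<subseteq> A)"

lemma ancestral_finite: "ancestral A \<Longrightarrow> finite A"
  using finite_V by (auto simp: ancestral_def intro: finite_subset)

lemma ancestral_V: "ancestral V"
  using parents_V by (auto simp: ancestral_def)

lemma ancestral_empty: "ancestral {}"
  by (simp add: ancestral_def)

text \<open>
  Removing a vertex from an ancestral set leaves an ancestral set only if the vertex is a sink,
  so this rule adds one sink after the other. It works since the vertices of \<open>A - A0\<close> can be
  listed compatibly with the arrows.
\<close>
lemma ancestral_induct [consumes 3, case_names base sink]:
  assumes "ancestral A0" "ancestral A" "A0 \<subseteq> A"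
    and "P A0"
    and step: "\<And>i A. ancestral A \<Longrightarrow> ancestral (insert i A) \<Longrightarrow> A0 \<subseteq> A \<Longrightarrow> i \<notin> A \<Longrightarrow> P A \<Longrightarrow> P (insert i A)"
  shows "P A"
  using assms(2,3)
proof (induction "card (A - A0)" arbitrary: A)
  case 0
  then have "A - A0 = {}" using ancestral_finite[of A] by simp
  then show ?case using 0 \<open>P A0\<close> by (metis Diff_eq_empty_iff subset_antisym)
next
  case (Suc n)
  then have fin: "finite (A - A0)" and ne: "A - A0 \<noteq> {}" using ancestral_finite[of A] by auto
  have "wf ((D \<inter> (A \<times> A))\<inverse>)"
    using acyclic_D ancestral_finite[OF Suc.prems(1)]
    by (intro finite_acyclic_wf_converse) (auto intro: acyclic_subset)
  then obtain i where i: "i \<in> A - A0" and max: "\<And>j. (i, j) \<in> D \<inter> (A \<times> A) \<Longrightarrow> j \<notin> A - A0"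
    using ne by (metis converse_iff ex_in_conv wfE_min)
  have no_child: "(i, j) \<notin> D" if "j \<in> A" for j
  proof
    assume "(i, j) \<in> D"
    then have "j \<in> A0" using max[of j] i that by auto
    then show False using \<open>ancestral A0\<close> i \<open>(i, j) \<in> D\<close> by (auto simp: ancestral_def parents_def)
  qed
  have anc: "ancestral (A - {i})"
    using Suc.prems no_child by (auto simp: ancestral_def parents_def)
  have "card (A - {i} - A0) = n"
  proof -
    have "A - {i} - A0 = (A - A0) - {i}" by auto
    then show ?thesis using Suc.hyps(2) i fin by simp
  qed
  with Suc.hyps(1) anc i Suc.prems have "P (A - {i})" by auto
  moreover have "insert i (A - {i}) = A" using i by auto
  ultimately show ?case
    using step[of "A - {i}" i] anc Suc.prems i by auto
qed

text \<open>A vertex that can be added last has no children yet, so its neighbours are its parents.\<close>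
lemma sink_neighbours:
  assumes "ancestral B" "ancestral (insert i B)" "i \<notin> B"
  shows "{j\<in>B. (j, i) \<in> E} = parents D i"
proof -
  have "(i, j) \<notin> D" if "j \<in> B" for j
    using assms that by (auto simp: ancestral_def parents_def)
  moreover have "parents D i \<subseteq> B"
    using assms not_parent_self[of i] by (auto simp: ancestral_def)
  ultimately show ?thesis using D_E by (auto simp: parents_def)
qed

lemma sink_parents: "ancestral (insert i B) \<Longrightarrow> i \<notin> B \<Longrightarrow> parents D i \<subseteq> B"
  using not_parent_self[of i] by (auto simp: ancestral_def)

lemma family_clique: 
  assumes "i \<in> V" shows "insert i (parents D i) \<in> cliques V E"
proof -
  have "(j, i) \<in> E" "(i, j) \<in> E" if "j \<in> parents D i" for j
    using that D_E by (auto simp: parents_def)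
  then show ?thesis
    unfolding cliques_def using assms parents_V[of i] parents_clique[of _ i] by blast
qed

end


section \<open>Counting lists of stable sets\<close>

text \<open>
  Expanding the \<open>m\<close>-th power of \<^const>\<open>stable_poly\<close> means choosing a stable set in each of the \<open>m\<close>
  factors; these are the choices that contribute to the monomial with exponents \<open>n\<close>.
\<close>
definition arrangements :: "'a rel \<Rightarrow> 'a set \<Rightarrow> nat \<Rightarrow> ('a \<Rightarrow> nat) \<Rightarrow> (nat \<Rightarrow> 'a set) set" where
  "arrangements E A m n =
    {f \<in> {..<m} \<rightarrow>\<^sub>E stable_sets E A. \<forall>i\<in>A. card {k \<in> {..<m}. i \<in> f k} = n i}"

lemma finite_arrangements: "finite A \<Longrightarrow> finite (arrangements E A m n)"
  unfolding arrangements_def by (simp add: finite_PiE finite_stable_sets)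

lemma single_zero_power: "(Poly_Mapping.single (0::'k::comm_monoid_add) (s::'c::comm_semiring_1)) ^ k = Poly_Mapping.single 0 (s ^ k)"
  by (induction k) (simp_all add: Poly_Mapping.mult_single)

lemma prod_single:
  fixes c :: "'b \<Rightarrow> 'c::comm_semiring_1" and e :: "'b \<Rightarrow> 'k::comm_monoid_add"
  shows "finite I \<Longrightarrow> (\<Prod>k\<in>I. Poly_Mapping.single (e k) (c k)) = Poly_Mapping.single (\<Sum>k\<in>I. e k) (\<Prod>k\<in>I. c k)"
  by (induction I rule: finite_induct) (simp_all add: Poly_Mapping.mult_single)

lemma lookup_stable_poly_power:
  fixes s :: real
  assumes "finite A"
  shows "Poly_Mapping.lookup (stable_poly (Poly_Mapping.single 0 s) E A indet ^ m) (exponent A n) =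
    s ^ (\<Sum>i\<in>A. n i) * real (card (arrangements E A m n))"
proof -
  let ?K = "stable_sets E A" and ?F = "{..<m} \<rightarrow>\<^sub>E stable_sets E A"
  define g where "g C = Poly_Mapping.single (exponent C (\<lambda>_. 1)) (s ^ card C)" for C :: "'a set"
  have finK: "finite C" if "C \<in> ?K" for C
    using that assms by (auto simp: stable_sets_def intro: finite_subset)
  have fin: "finite ?F" using assms by (intro finite_PiE) (auto simp: finite_stable_sets)
  have "stable_poly (Poly_Mapping.single 0 s) E A indet = (\<Sum>C\<in>?K. g C)"
    unfolding stable_poly_def g_def
    by (intro sum.cong refl) (simp add: finK prod_indet single_zero_power Poly_Mapping.mult_single)
  then have "stable_poly (Poly_Mapping.single 0 s) E A indet ^ m = (\<Prod>k<m. \<Sum>C\<in>?K. g C)"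
    by simp
  also have "\<dots> = (\<Sum>f\<in>?F. \<Prod>k<m. g (f k))"
    using assms by (intro prod_sum_PiE) (auto simp: finite_stable_sets)
  also have "\<dots> = (\<Sum>f\<in>?F. Poly_Mapping.single (\<Sum>k<m. exponent (f k) (\<lambda>_. 1)) (\<Prod>k<m. s ^ card (f k)))"
    unfolding g_def by (simp add: prod_single)
  finally have "Poly_Mapping.lookup (stable_poly (Poly_Mapping.single 0 s) E A indet ^ m) (exponent A n) =
    (\<Sum>f\<in>?F. Poly_Mapping.lookup (Poly_Mapping.single (\<Sum>k<m. exponent (f k) (\<lambda>_. 1)) (\<Prod>k<m. s ^ card (f k)))
      (exponent A n))"
    by (simp only: lookup_sum)
  also have "\<dots> = (\<Sum>f\<in>?F. if f \<in> arrangements E A m n then s ^ (\<Sum>i\<in>A. n i) else 0)"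
  proof (intro sum.cong refl)
    fix f assume f: "f \<in> ?F"
    have fA: "f k \<subseteq> A" "finite (f k)" if "k < m" for k
      using f that finK[of "f k"] by (auto simp: stable_sets_def)
    have lk: "Poly_Mapping.lookup (\<Sum>k<m. exponent (f k) (\<lambda>_. 1)) i = card {k \<in> {..<m}. i \<in> f k}" for i
    proof -
      have "Poly_Mapping.lookup (\<Sum>k<m. exponent (f k) (\<lambda>_. 1)) i = (\<Sum>k<m. if i \<in> f k then 1 else 0)"
        unfolding lookup_sum by (intro sum.cong refl lookup_exponent) (use fA in auto)
      then show ?thesis by (simp add: sum.If_cases Int_def)
    qed
    have empty: "{k \<in> {..<m}. i \<in> f k} = {}" if "i \<notin> A" for i
      using fA that by fastforce
    have iff: "(\<Sum>k<m. exponent (f k) (\<lambda>_. 1)) = exponent A n \<longleftrightarrow> f \<in> arrangements E A m n"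
      using f empty unfolding poly_mapping_eq_iff fun_eq_iff lk lookup_exponent[OF assms]
      by (auto simp: arrangements_def)
    have "(\<Prod>k<m. s ^ card (f k)) = s ^ (\<Sum>i\<in>A. n i)" if "f \<in> arrangements E A m n"
    proof -
      have "(\<Sum>k<m. card (f k)) = (\<Sum>k<m. \<Sum>i\<in>A. if i \<in> f k then 1 else 0)"
        using fA assms by (intro sum.cong refl) (auto simp: sum.If_cases Int_absorb1)
      also have "\<dots> = (\<Sum>i\<in>A. \<Sum>k<m. if i \<in> f k then 1 else 0)"
        by (rule sum.swap)
      also have "\<dots> = (\<Sum>i\<in>A. n i)"
        using that by (intro sum.cong refl) (auto simp: arrangements_def sum.If_cases Int_def)
      finally show ?thesis by (simp flip: power_sum)
    qed
    then show "Poly_Mapping.lookup (Poly_Mapping.single (\<Sum>k<m. exponent (f k) (\<lambda>_. 1)) (\<Prod>k<m. s ^ card (f k)))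
        (exponent A n) = (if f \<in> arrangements E A m n then s ^ (\<Sum>i\<in>A. n i) else 0)"
      using iff by (simp add: lookup_single when_def)
  qed
  also have "\<dots> = (\<Sum>f\<in>arrangements E A m n. s ^ (\<Sum>i\<in>A. n i))"
    using fin by (intro sum.mono_neutral_cong_right) (auto simp: arrangements_def)
  finally show ?thesis by simp
qed

text \<open>
  No stable set contains two members of a clique, so different members occupy disjoint sets of
  positions.
\<close>
lemma sum_over_clique_eq_card:
  assumes f: "f \<in> arrangements E A m n" and C: "C \<subseteq> A" "finite C"
    "\<And>i j. i \<in> C \<Longrightarrow> j \<in> C \<Longrightarrow> i \<noteq> j \<Longrightarrow> (i, j) \<in> E"
  shows "(\<Sum>j\<in>C. n j) = card {k \<in> {..<m}. f k \<inter> C \<noteq> {}}"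
proof -
  have "{k \<in> {..<m}. f k \<inter> C \<noteq> {}} = (\<Union>j\<in>C. {k \<in> {..<m}. j \<in> f k})" by auto
  moreover have "card (\<Union>j\<in>C. {k \<in> {..<m}. j \<in> f k}) = (\<Sum>j\<in>C. card {k \<in> {..<m}. j \<in> f k})"
  proof (rule card_UN_disjoint)
    show "\<forall>i\<in>C. \<forall>j\<in>C. i \<noteq> j \<longrightarrow> {k \<in> {..<m}. i \<in> f k} \<inter> {k \<in> {..<m}. j \<in> f k} = {}"
    proof (intro ballI impI)
      fix i j assume ij: "i \<in> C" "j \<in> C" "i \<noteq> j"
      then have "(i, j) \<in> E" using C by blast
      moreover have "f k \<in> stable_sets E A" if "k < m" for k
        using f that by (auto simp: arrangements_def)
      ultimately show "{k \<in> {..<m}. i \<in> f k} \<inter> {k \<in> {..<m}. j \<in> f k} = {}"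
        by (fastforce simp: stable_sets_def)
    qed
  qed (use C in auto)
  moreover have "(\<Sum>j\<in>C. card {k \<in> {..<m}. j \<in> f k}) = (\<Sum>j\<in>C. n j)"
    using f C by (intro sum.cong) (auto simp: arrangements_def)
  ultimately show ?thesis by simp
qed

lemma sum_over_clique_le:
  assumes "f \<in> arrangements E A m n" "C \<subseteq> A" "finite C"
    "\<And>i j. i \<in> C \<Longrightarrow> j \<in> C \<Longrightarrow> i \<noteq> j \<Longrightarrow> (i, j) \<in> E"
  shows "(\<Sum>j\<in>C. n j) \<le> m"
proof -
  have "card {k \<in> {..<m}. f k \<inter> C \<noteq> {}} \<le> card {..<m}" by (intro card_mono) auto
  then show ?thesis using sum_over_clique_eq_card[OF assms] by simp
qed

context moral_graph
begin

text \<open>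
  The sink \<open>i\<close> can be put into any \<open>n i\<close> of the stable sets that contain none of its neighbours,
  and its neighbours in \<open>B\<close> are its parents.
\<close>
lemma card_arrangements_insert:
  assumes "ancestral B" "ancestral (insert i B)" "i \<notin> B"
  shows "card (arrangements E (insert i B) m n) =
    (\<Sum>f\<in>arrangements E B m n. card {k \<in> {..<m}. f k \<inter> parents D i = {}} choose n i)"
proof -
  let ?free = "\<lambda>f. {k \<in> {..<m}. f k \<inter> parents D i = {}}"
  let ?S = "SIGMA f:arrangements E B m n. {S. S \<subseteq> ?free f \<and> card S = n i}"
  let ?to = "\<lambda>f. (\<lambda>k\<in>{..<m}. f k - {i}, {k \<in> {..<m}. i \<in> f k})"
  let ?from = "\<lambda>(f, S). \<lambda>k\<in>{..<m}. if k \<in> S then insert i (f k) else f k"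
  have nb: "(j, i) \<in> E \<longleftrightarrow> j \<in> parents D i" "(i, j) \<in> E \<longleftrightarrow> j \<in> parents D i" if "j \<in> B" for j
    using sink_neighbours[OF assms] that symD[OF sym_E] by blast+
  have ii: "(i, i) \<notin> E" using irrefl_E by (simp add: irrefl_def)
  have PB: "parents D i \<subseteq> B" by (rule sink_parents[OF assms(2,3)])
  have "bij_betw ?to (arrangements E (insert i B) m n) ?S"
  proof (rule bij_betw_byWitness[where f' = ?from])
    show "\<forall>f\<in>arrangements E (insert i B) m n. ?from (?to f) = f"
      by (auto simp: arrangements_def fun_eq_iff restrict_def PiE_def extensional_def)
    show "\<forall>p\<in>?S. ?to (?from p) = p"
    proof
      fix p assume "p \<in> ?S"
      then obtain f S where p: "p = (f, S)" "f \<in> arrangements E B m n" "S \<subseteq> ?free f" by auto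
      have "i \<notin> f k" if "k < m" for k
        using p(2) that assms(3) by (auto simp: arrangements_def stable_sets_def)
      then show "?to (?from p) = p"
        using p by (auto simp: arrangements_def fun_eq_iff PiE_def extensional_def)
    qed
    show "?to ` arrangements E (insert i B) m n \<subseteq> ?S"
    proof (rule image_subsetI)
      fix f assume f: "f \<in> arrangements E (insert i B) m n"
      have st: "f k \<in> stable_sets E (insert i B)" if "k < m" for k
        using f that by (auto simp: arrangements_def)
      have "f k - {i} \<in> stable_sets E B" if "k < m" for k
        using st[OF that] by (auto simp: stable_sets_def)
      moreover have "card {k \<in> {..<m}. j \<in> (\<lambda>k\<in>{..<m}. f k - {i}) k} = n j" if "j \<in> B" for j
      proof -
        have "j \<noteq> i" using that assms(3) by auto
        then have "{k \<in> {..<m}. j \<in> (\<lambda>k\<in>{..<m}. f k - {i}) k} = {k \<in> {..<m}. j \<in> f k}" by auto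
        then show ?thesis using f that by (simp add: arrangements_def)
      qed
      moreover have "f k \<inter> parents D i = {}" if "k < m" "i \<in> f k" for k
      proof (rule ccontr)
        assume "f k \<inter> parents D i \<noteq> {}"
        then obtain j where j: "j \<in> f k" "j \<in> parents D i" by blast
        then have "(j, i) \<in> E" using nb PB by blast
        then show False using st[OF that(1)] that(2) j(1) by (simp add: stable_sets_def)
      qed
      moreover have "card {k \<in> {..<m}. i \<in> f k} = n i"
        using f by (simp add: arrangements_def)
      ultimately show "?to f \<in> ?S" by (auto simp: arrangements_def)
    qed
    show "?from ` ?S \<subseteq> arrangements E (insert i B) m n"
    proof (rule image_subsetI)
      fix p assume "p \<in> ?S"
      then obtain f S where p: "p = (f, S)" "f \<in> arrangements E B m n" "S \<subseteq> ?free f" "card S = n i"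
        by auto
      have st: "f k \<in> stable_sets E B" if "k < m" for k
        using p that by (auto simp: arrangements_def)
      then have inf: "i \<notin> f k" if "k < m" for k
        using that assms(3) by (auto simp: stable_sets_def)
      have "?from p k \<in> stable_sets E (insert i B)" if "k < m" for k
      proof (cases "k \<in> S")
        case True
        then have "f k \<inter> parents D i = {}" using p by auto
        moreover have "f k \<subseteq> B" using st[OF that] by (auto simp: stable_sets_def)
        ultimately have "(i, j) \<notin> E" "(j, i) \<notin> E" if "j \<in> f k" for j
          using that nb by blast+
        then show ?thesis
          using st[OF that] that True ii p(1) by (auto simp: stable_sets_def)
      qed (use st[OF that] that p in \<open>auto simp: stable_sets_def\<close>)
      moreover have "card {k \<in> {..<m}. j \<in> ?from p k} = n j" if "j \<in> B" for j
      proof -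
        have "j \<noteq> i" using that assms(3) by auto
        then have "{k \<in> {..<m}. j \<in> ?from p k} = {k \<in> {..<m}. j \<in> f k}" using p by auto
        then show ?thesis using p that by (simp add: arrangements_def)
      qed
      moreover have "card {k \<in> {..<m}. i \<in> ?from p k} = n i"
      proof -
        have "{k \<in> {..<m}. i \<in> ?from p k} = S" using p inf by auto
        then show ?thesis using p by simp
      qed
      moreover have "?from p \<in> extensional {..<m}" using p by auto
      ultimately show "?from p \<in> arrangements E (insert i B) m n"
        by (auto simp: arrangements_def PiE_def)
    qed
  qed
  then have "card (arrangements E (insert i B) m n) = card ?S"
    by (rule bij_betw_same_card)
  also have "\<dots> = (\<Sum>f\<in>arrangements E B m n. card {S. S \<subseteq> ?free f \<and> card S = n i})"
    using finite_arrangements[OF ancestral_finite[OF assms(1)]] by (intro card_SigmaI) auto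
  also have "\<dots> = (\<Sum>f\<in>arrangements E B m n. card (?free f) choose n i)"
    by (intro sum.cong refl n_subsets) auto
  finally show ?thesis .
qed

text \<open>
  By the lemma \<open>sum_over_clique_eq_card\<close>, the parents of the next vertex occupy as many positions as their
  counts add up to. If this exceeds \<open>m\<close>, there is no arrangement to extend; this is why the
  product is correct even when the upper argument of a binomial coefficient is negative.
\<close>
lemma card_arrangements:
  assumes "ancestral A"
  shows "real (card (arrangements E A m n)) =
    (\<Prod>i\<in>A. (real m - real (\<Sum>j\<in>parents D i. n j)) gchoose n i)"
  using ancestral_empty assms empty_subsetI
proof (induction rule: ancestral_induct)
  case base
  have "arrangements E {} m n = {..<m} \<rightarrow>\<^sub>E {{}}"
    by (simp add: arrangements_def stable_sets_empty)
  then show ?case by (simp add: card_PiE)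
next
  case (sink i B)
  let ?Q = "parents D i"
  have PB: "?Q \<subseteq> B" by (rule sink_parents) fact+
  have "card {k \<in> {..<m}. f k \<inter> ?Q = {}} = m - (\<Sum>j\<in>?Q. n j) \<and> (\<Sum>j\<in>?Q. n j) \<le> m"
    if f: "f \<in> arrangements E B m n" for f
  proof -
    have "{k \<in> {..<m}. f k \<inter> ?Q = {}} = {..<m} - {k \<in> {..<m}. f k \<inter> ?Q \<noteq> {}}" by auto
    moreover have "card ({..<m} - {k \<in> {..<m}. f k \<inter> ?Q \<noteq> {}}) = m - card {k \<in> {..<m}. f k \<inter> ?Q \<noteq> {}}"
      by (subst card_Diff_subset) auto
    ultimately show ?thesis
      using sum_over_clique_eq_card[OF f PB finite_parents parents_clique[of _ i]]
        sum_over_clique_le[OF f PB finite_parents parents_clique[of _ i]] by simp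
  qed
  then have "real (card (arrangements E (insert i B) m n)) =
      (\<Sum>f\<in>arrangements E B m n. (real m - real (\<Sum>j\<in>?Q. n j)) gchoose n i)"
    unfolding card_arrangements_insert[OF sink(1,2,4)] of_nat_sum
    by (intro sum.cong refl) (simp add: binomial_gbinomial of_nat_diff)
  then show ?case
    using sink ancestral_finite[of B] by simp
qed

end


section \<open>The coefficients of both models\<close>

lemma lookup_of_nat_mult:
  "Poly_Mapping.lookup (of_nat c * p) e = real c * Poly_Mapping.lookup p e"
  for p :: "('a \<Rightarrow>\<^sub>0 nat) \<Rightarrow>\<^sub>0 real"
  by (induction c) (simp_all add: distrib_right lookup_add)

lemma real_polynomial_function_gchoose_compose:
  assumes "real_polynomial_function f"
  shows "real_polynomial_function (\<lambda>x. f x gchoose k)"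
proof -
  have "real_polynomial_function (\<lambda>x. (\<Prod>i = 0..<k. f x - real i) * inverse (fact k))"
    by (intro real_polynomial_function.intros(2-) real_polynomial_function_prod
        real_polynomial_function_diff assms) auto
  then show ?thesis by (simp add: gbinomial_prod_rev field_simps)
qed

lemma real_polynomial_function_eqI:
  fixes f g :: "real \<Rightarrow> real"
  assumes "real_polynomial_function f" "real_polynomial_function g"
    and eq: "\<And>m::nat. f (- real m) = g (- real m)"
  shows "f x = g x"
proof -
  have "real_polynomial_function (\<lambda>x. f x - g x)"
    using assms by (intro real_polynomial_function_diff)
  then obtain a N where a: "\<And>x. f x - g x = (\<Sum>i\<le>N. a i * x ^ i)"
    unfolding real_polynomial_function_iff_sum by meson
  have "range (\<lambda>m::nat. - real m) \<subseteq> {z. (\<Sum>i\<le>N. a i * z ^ i) = 0}"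
    using eq by (auto simp flip: a)
  moreover have "infinite (range (\<lambda>m::nat. - real m))"
    by (intro range_inj_infinite) (simp add: inj_def)
  ultimately have "\<not> finite {z. (\<Sum>i\<le>N. a i * z ^ i) = 0}"
    using finite_subset by blast
  then have "\<forall>i\<le>N. a i = 0"
    using polyfun_finite_roots[of a N] by blast
  then have "f x - g x = 0" unfolding a by simp
  then show ?thesis by simp
qed

context moral_graph
begin

text \<open>
  The coefficient of \<open>x^n\<close> in the \<open>\<rho>\<close>-th power of \<open>stable_poly s E A x\<close>, for ancestral \<open>A\<close>.
\<close>
definition power_coeff :: "real \<Rightarrow> real \<Rightarrow> 'a set \<Rightarrow> ('a \<Rightarrow> nat) \<Rightarrow> real" where
  "power_coeff s \<rho> A n = (\<Prod>i\<in>A. s ^ n i * ((\<rho> - real (\<Sum>j\<in>parents D i. n j)) gchoose n i))"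

lemma stable_poly_power_coeff:
  assumes "ancestral A"
  shows "Poly_Mapping.lookup (stable_poly (Poly_Mapping.single 0 s) E A indet ^ m) (exponent A n) =
    power_coeff s (real m) A n"
  unfolding lookup_stable_poly_power[OF ancestral_finite[OF assms]] card_arrangements[OF assms]
  by (simp add: power_coeff_def prod.distrib power_sum)

lemma Delta_eq: "Delta V E x = stable_poly (- 1) E V x"
  by (simp add: Delta_def stable_poly_def cliques_complement_graph irrefl_E)

lemma delta_eq: "delta V E x = stable_poly 1 E V x"
  by (simp add: delta_def stable_poly_def cliques_complement_graph irrefl_E)

lemma mult_coeff_eq: "mult_coeff V E m n = power_coeff 1 (real m) V n"
  unfolding mult_coeff_def delta_eq
  using stable_poly_power_coeff[OF ancestral_V, of 1] by (simp add: Poly_Mapping.single_one)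

text \<open>
  At \<open>r = - m\<close> the binomial series is the finite binomial expansion of the \<open>m\<close>-th power, which
  the count of arrangements evaluates. Both sides are polynomials in \<open>r\<close>, so that these values determine them.
\<close>
lemma nm_coeff_eq: "nm_coeff V E r n = power_coeff (- 1) (- r) V n"
proof (rule real_polynomial_function_eqI[where x = r])
  show "real_polynomial_function (\<lambda>r. nm_coeff V E r n)"
    unfolding nm_coeff_def
    by (intro real_polynomial_function_sum real_polynomial_function.intros(2-)
        real_polynomial_function_gchoose_compose real_polynomial_function_minus) 
      (auto intro!: real_polynomial_function.intros)
  show "real_polynomial_function (\<lambda>r. power_coeff (- 1) (- r) V n)"
    unfolding power_coeff_def
    by (intro real_polynomial_function_prod real_polynomial_function.intros(2-) finite_V
        real_polynomial_function_gchoose_compose real_polynomial_function_diff real_polynomial_function_minus) 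
      (auto intro!: real_polynomial_function.intros)
next
  fix m :: nat
  let ?N = "\<Sum>i\<in>V. n i" and ?D = "Delta V E (indet :: 'a \<Rightarrow> _)"
  let ?l = "\<lambda>k. Poly_Mapping.lookup ((?D - 1) ^ k) (exponent V n)"
  have "?D ^ m = ((?D - 1) + 1) ^ m" by simp
  also have "\<dots> = (\<Sum>k\<le>m. of_nat (m choose k) * (?D - 1) ^ k)"
    unfolding binomial_ring by simp
  finally have "Poly_Mapping.lookup (?D ^ m) (exponent V n) = 
      (\<Sum>k\<le>m. Poly_Mapping.lookup (of_nat (m choose k) * (?D - 1) ^ k) (exponent V n))"
    by (simp only: lookup_sum)
  also have "\<dots> = (\<Sum>k\<le>m. real (m choose k) * ?l k)"
    by (simp add: lookup_of_nat_mult)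
  also have "\<dots> = (\<Sum>k\<le>max m ?N. real (m choose k) * ?l k)"
    by (intro sum.mono_neutral_left) auto
  also have "\<dots> = (\<Sum>k\<le>?N. real (m choose k) * ?l k)"
    using lookup_Delta_minus_1_power[OF finite_V] by (intro sum.mono_neutral_right) auto
  also have "\<dots> = nm_coeff V E (- real m) n"
    by (simp add: nm_coeff_def binomial_gbinomial)
  finally have "nm_coeff V E (- real m) n = Poly_Mapping.lookup (?D ^ m) (exponent V n)" ..
  also have "\<dots> = power_coeff (- 1) (real m) V n"
    unfolding Delta_eq using stable_poly_power_coeff[OF ancestral_V, of "-1"]
    by (simp add: single_uminus Poly_Mapping.single_one)
  finally show "nm_coeff V E (- real m) n = power_coeff (- 1) (- (- real m)) V n" by simp
qed

lemma coeff_insert: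
  assumes "ancestral B" "i \<notin> B" 
  shows "power_coeff s \<rho> (insert i B) n = power_coeff s \<rho> B n * (s ^ n i * ((\<rho> - real (\<Sum>j\<in>parents D i. n j)) gchoose n i))"
  using assms ancestral_finite by (simp add: power_coeff_def)

lemma coeff_cong:
  assumes "ancestral B" "\<And>j. j \<in> B \<Longrightarrow> n j = n' j"
  shows "power_coeff s \<rho> B n = power_coeff s \<rho> B n'"
proof -
  have "(\<Sum>j\<in>parents D i. n j) = (\<Sum>j\<in>parents D i. n' j)" if "i \<in> B" for i
    using assms that by (intro sum.cong) (auto simp: ancestral_def)
  then show ?thesis unfolding power_coeff_def using assms(2) by (intro prod.cong) auto
qed

lemma coeff_negative_multinomial_nonneg:
  assumes "\<rho> < 0" shows "power_coeff (- 1) \<rho> A n \<ge> 0"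
  unfolding power_coeff_def
proof (intro prod_nonneg)
  fix i assume "i \<in> A"
  have "(- 1) ^ k * ((\<rho> - real q) gchoose k) \<ge> 0" for k q
  proof -
    have "(- 1) ^ k * ((\<rho> - real q) gchoose k) = pochhammer (real q - \<rho>) k / fact k"
      by (simp add: gbinomial_pochhammer flip: power_add)
    then show ?thesis using assms by (simp add: pochhammer_nonneg)
  qed
  then show "0 \<le> (- 1) ^ n i * (\<rho> - real (sum n (parents D i)) gchoose n i)" .
qed

lemma coeff_multinomial_nonneg: "ancestral A \<Longrightarrow> power_coeff 1 (real m) A n \<ge> 0"
  using card_arrangements[of A m n] by (simp add: power_coeff_def flip: card_arrangements)

text \<open>
  A nonzero coefficient is witnessed by a list of \<open>m\<close> stable sets, over which the members of \<open>C\<close>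
  are spread disjointly.
\<close>
lemma coeff_multinomial_clique_le:
  assumes "ancestral A" "power_coeff 1 (real m) A n \<noteq> 0" "C \<in> cliques V E" "C \<subseteq> A"
  shows "(\<Sum>j\<in>C. n j) \<le> m"
proof -
  have "card (arrangements E A m n) \<noteq> 0"
    using assms(2) card_arrangements[OF assms(1), of m n] by (auto simp: power_coeff_def)
  then obtain f where "f \<in> arrangements E A m n"
    by fastforce
  then show ?thesis
    using assms(3,4) finite_subset[OF assms(4) ancestral_finite[OF assms(1)]]
    by (intro sum_over_clique_le[of f E A m n C]) (auto simp: cliques_def)
qed

lemma max_clique_exists: "C \<in> cliques V E \<Longrightarrow> \<exists>C'\<in>max_cliques V E. C \<subseteq> C'"
proof -
  assume C: "C \<in> cliques V E"
  have "finite (cliques V E)"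
    by (rule finite_subset[of _ "Pow V"]) (auto simp: cliques_def finite_V)
  then obtain C' where "C' \<in> cliques V E" "C \<subseteq> C'" "\<forall>B\<in>cliques V E. C' \<subseteq> B \<longrightarrow> C' = B"
    using C finite_has_maximal2[of "cliques V E" C] by blast
  then show ?thesis by (auto simp: max_cliques_def)
qed

lemma finite_max_cliques: "finite (max_cliques V E)" "max_cliques V E \<noteq> {}"
proof -
  show "finite (max_cliques V E)"
    by (rule finite_subset[of _ "Pow V"]) (auto simp: cliques_def max_cliques_def finite_V)
  show "max_cliques V E \<noteq> {}"
    using max_clique_exists[of "{}"] by (auto simp: cliques_def)
qed

lemma clique_sum_less:
  assumes "\<And>i. i \<in> V \<Longrightarrow> \<alpha> i \<ge> (0::real)" "Max ((\<lambda>C. \<Sum>i\<in>C. \<alpha> i) ` max_cliques V E) < \<beta>" "C \<in> cliques V E"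
  shows "(\<Sum>i\<in>C. \<alpha> i) < \<beta>"
proof -
  obtain C' where C': "C' \<in> max_cliques V E" "C \<subseteq> C'"
    using max_clique_exists[OF assms(3)] by blast
  then have "C' \<subseteq> V" by (auto simp: max_cliques_def cliques_def)
  then have "(\<Sum>i\<in>C. \<alpha> i) \<le> (\<Sum>i\<in>C'. \<alpha> i)"
    using C'(2) assms(1) finite_subset[OF _ finite_V] by (intro sum_mono2) auto
  also have "\<dots> \<le> Max ((\<lambda>C. \<Sum>i\<in>C. \<alpha> i) ` max_cliques V E)"
    using C' finite_max_cliques by (intro Max_ge) auto
  finally show ?thesis using assms(2) by simp
qed

text \<open>
  The indicator in \<^const>\<open>multinomial\<close> vanishes only where the coefficient does, which brings the
  multinomial law into the common form of both models.
\<close>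
lemma mult_coeff_support:
  assumes "n \<in> V \<rightarrow>\<^sub>E UNIV" "mult_coeff V E m n \<noteq> 0"
  shows "n \<in> mult_support V E m"
proof -
  have "(\<Sum>j\<in>C. n j) \<le> m" if "C \<in> max_cliques V E" for C
    using coeff_multinomial_clique_le[OF ancestral_V, of m n C] assms(2) that
    by (auto simp: mult_coeff_eq max_cliques_def cliques_def)
  then show ?thesis using assms(1) finite_max_cliques by (auto simp: mult_support_def)
qed

end


section \<open>Eliminating a sink from the parameter\<close>

context moral_graph
begin

text \<open>
  The parameter that remains on \<open>B\<close> when the sink \<open>i\<close> of \<open>insert i B\<close> is summed out.
\<close>
definition eliminate :: "real \<Rightarrow> 'a \<Rightarrow> 'a set \<Rightarrow> ('a \<Rightarrow> real) \<Rightarrow> ('a \<Rightarrow> real)" where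
  "eliminate s i B x = (\<lambda>j\<in>B. if j \<in> parents D i then x j / (1 + s * x i) else x j)"

text \<open>
  Splitting off \<open>i\<close> gives \<open>P\<^sub>S(x) + s * x i * P\<^sub>R(x)\<close> with \<open>R = S - parents D i\<close>. On the other hand
  \<open>P\<^sub>S\<close> is affine in the variables of the parents, with \<open>P\<^sub>R\<close> as the part free of them, so that
  dividing these variables by \<open>1 + s * x i\<close> and multiplying the result by \<open>1 + s * x i\<close> gives the same sum.
\<close>
lemma stable_poly_eliminate:
  assumes anc: "ancestral B" "ancestral (insert i B)" "i \<notin> B" and S: "S \<subseteq> B" and nz: "1 + s * x i \<noteq> 0"
  defines "Q \<equiv> parents D i" and "x' \<equiv> eliminate s i B x"
  shows "stable_poly s E (insert i S) x = (1 + s * x i) * stable_poly s E S x'"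
    and "stable_poly s E S x = (1 + s * x i) * stable_poly s E S x' - s * x i * stable_poly s E (S - Q) x'"
proof -
  have fin: "finite S" using S ancestral_finite[OF anc(1)] finite_subset by blast
  have "S - {j. (j, i) \<in> E} = S - Q"
    using sink_neighbours[OF anc] S by (auto simp: Q_def)
  then have ins: "stable_poly s E (insert i S) x = stable_poly s E S x + s * x i * stable_poly s E (S - Q) x"
    using stable_poly_insert[OF fin _ sym_E irrefl_E, of i s x] anc(3) S by auto
  have "stable_poly s E S x' = stable_poly s E S (\<lambda>j. if j \<in> Q then 1 / (1 + s * x i) * x j else x j)"
    by (rule stable_poly_cong) (use S in \<open>auto simp: x'_def Q_def eliminate_def\<close>)
  also have "\<dots> = stable_poly s E (S - Q) x + 1 / (1 + s * x i) * (stable_poly s E S x - stable_poly s E (S - Q) x)"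
    using parents_clique by (intro stable_poly_scale_clique fin) (auto simp: Q_def)
  finally have sc: "(1 + s * x i) * stable_poly s E S x' =
      stable_poly s E S x + s * x i * stable_poly s E (S - Q) x"
    using nz by (simp add: field_simps)
  show "stable_poly s E (insert i S) x = (1 + s * x i) * stable_poly s E S x'"
    using ins sc by simp
  have "stable_poly s E (S - Q) x' = stable_poly s E (S - Q) x"
    by (rule stable_poly_cong) (use S in \<open>auto simp: x'_def Q_def eliminate_def\<close>)
  then show "stable_poly s E S x = (1 + s * x i) * stable_poly s E S x' - s * x i * stable_poly s E (S - Q) x'"
    using sc by simp
qed

text \<open>
  For \<open>s = - 1\<close> this is \<^const>\<open>M_set\<close>; for \<open>s = 1\<close> it consists of all positive vectors.
\<close>
definition params :: "real \<Rightarrow> 'a set \<Rightarrow> ('a \<Rightarrow> real) set" where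
  "params s A = {x \<in> A \<rightarrow>\<^sub>E {0<..}. \<forall>S\<subseteq>A. stable_poly s E S x > 0}"

text \<open>
  Together with \<open>x i\<close>, the eliminated parameter ranges over a product set. For sets that contain \<open>i\<close>
  both conditions agree by the factorisation of \<^const>\<open>stable_poly\<close>. For sets \<open>S\<close> without \<open>i\<close> and \<open>s = - 1\<close>,
  \<open>P\<^sub>S(x)\<close> is a positive combination of values of \<^const>\<open>stable_poly\<close> at the eliminated parameter.
\<close>
lemma params_insert_iff:
  assumes anc: "ancestral B" "ancestral (insert i B)" "i \<notin> B" and s: "s = 1 \<or> s = - 1"
    and x: "x \<in> extensional (insert i B)"
  shows "x \<in> params s (insert i B) \<longleftrightarrow> x i > 0 \<and> 1 + s * x i > 0 \<and> eliminate s i B x \<in> params s B"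
    (is "_ \<longleftrightarrow> _ \<and> _ \<and> ?x' \<in> _")
proof (intro iffI conjI)
  assume P: "x \<in> params s (insert i B)"
  then show xi: "x i > 0" by (auto simp: params_def)
  have "stable_poly s E (insert i {}) x > 0"
    using P by (simp add: params_def)
  then show pos: "1 + s * x i > 0"
    using stable_poly_insert[of "{}" i E s x] by (simp add: sym_E irrefl_E stable_poly_empty)
  have "stable_poly s E S ?x' > 0" if "S \<subseteq> B" for S
  proof -
    have "insert i S \<subseteq> insert i B" using that by auto
    then have "stable_poly s E (insert i S) x > 0" using P unfolding params_def by blast
    then show ?thesis
      using stable_poly_eliminate(1)[OF anc that, of s x] pos by (simp add: zero_less_mult_iff)
  qed
  moreover have "x j > 0" if "j \<in> B" for j using P that by (auto simp: params_def)
  then have "?x' \<in> B \<rightarrow>\<^sub>E {0<..}"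
    using pos by (auto simp: eliminate_def)
  ultimately show "?x' \<in> params s B"
    by (simp add: params_def)
next
  assume r: "x i > 0 \<and> 1 + s * x i > 0 \<and> ?x' \<in> params s B"
  then have pos: "1 + s * x i > 0" and x': "?x' \<in> params s B" by auto
  have xj: "x j > 0" if "j \<in> B" for j
  proof -
    have "?x' j > 0" using x' that by (auto simp: params_def)
    then show ?thesis using that pos by (auto simp: eliminate_def zero_less_divide_iff split: if_splits)
  qed
  have nn: "stable_poly s E S x > 0" if S: "S \<subseteq> B" for S
  proof (cases "s = 1")
    case True
    then show ?thesis using xj S ancestral_finite[OF anc(1)] 
      by (auto intro!: stable_poly_pos intro: finite_subset)
  next
    case False
    then have "s = - 1" using s by auto
    moreover have "S - parents D i \<subseteq> B" using S by auto
    then have "stable_poly s E S ?x' > 0" "stable_poly s E (S - parents D i) ?x' > 0"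
      using x' S unfolding params_def by blast+
    ultimately show ?thesis
      using stable_poly_eliminate(2)[OF anc S, of s x] pos r by (simp add: add_pos_pos)
  qed
  have "stable_poly s E S x > 0" if S: "S \<subseteq> insert i B" for S
  proof (cases "i \<in> S")
    case True
    then have S': "insert i (S - {i}) = S" "S - {i} \<subseteq> B" using S by auto
    then have "stable_poly s E (S - {i}) ?x' > 0" using x' by (auto simp: params_def)
    then show ?thesis
      using stable_poly_eliminate(1)[OF anc S'(2), of s x] pos S' by simp
  qed (use S nn[of S] in auto)
  then show "x \<in> params s (insert i B)"
    using x xj r by (auto simp: params_def PiE_def)
qed

end


section \<open>The sampling law and its marginals\<close>

text \<open>
  The common form of both models. The exponent of the coefficients is \<open>\<rho>\<close> and the exponent of the prior
  is \<open>\<gamma>\<close>; the bounds on \<open>\<gamma>\<close> are what makes the prior integrable. The normalising factor \<open>pw\<close> of the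
  sampling law is \<open>t powr r\<close> in the first model and \<open>1 / t ^ r\<close> in the second. It is a parameter
  because the second expression is \<open>t powr (- \<rho>)\<close> only for positive \<open>t\<close>, while the probabilities
  have to be measurable functions of an arbitrary vector.
\<close>
locale graph_model = moral_graph V E D for V :: "'a set" and E D +
  fixes s \<rho> \<gamma> :: real and \<alpha> :: "'a \<Rightarrow> real" and pw :: "real \<Rightarrow> real"
  assumes sign: "s = - 1 \<and> \<rho> < 0 \<and> \<gamma> > - 1 \<or>
      s = 1 \<and> \<rho> \<in> \<nat> \<and> (\<forall>C\<in>cliques V E. \<gamma> + (\<Sum>i\<in>C. \<alpha> i) < 0)"
    and \<alpha>_pos: "\<And>i. i \<in> V \<Longrightarrow> \<alpha> i > 0"
    and pw_measurable [measurable]: "pw \<in> borel_measurable borel"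
    and pw_pos: "\<And>t. t > 0 \<Longrightarrow> pw t = t powr (- \<rho>)"
begin

lemma s_cases: "s = 1 \<or> s = - 1"
  using sign by auto

abbreviation "P \<equiv> stable_poly s E"

definition mass :: "'a set \<Rightarrow> ('a \<Rightarrow> real) \<Rightarrow> ('a \<Rightarrow> nat) \<Rightarrow> real" where
  "mass A x n = power_coeff s \<rho> A n * (\<Prod>i\<in>A. x i ^ n i) * pw (P A x)"

definition law :: "'a set \<Rightarrow> ('a \<Rightarrow> real) \<Rightarrow> ('a \<Rightarrow> nat) measure" where
  "law A x = density (count_space (A \<rightarrow>\<^sub>E UNIV)) (\<lambda>n. ennreal (mass A x n))"

text \<open>
  The probability of \<open>N\<^sub>i = k\<close> when the counts of the parents of \<open>i\<close> add up to \<open>c\<close>: negative binomial with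
  parameters \<open>c - \<rho>\<close> and \<open>u\<close> for \<open>s = - 1\<close>, binomial with parameters \<open>\<rho> - c\<close> and \<open>u / (1 + u)\<close> for \<open>s = 1\<close>.
\<close>
definition cond_mass :: "real \<Rightarrow> nat \<Rightarrow> nat \<Rightarrow> real" where
  "cond_mass u c k = s ^ k * ((\<rho> - real c) gchoose k) * u ^ k * (1 + s * u) powr (real c - \<rho>)"

lemma coeff_nonneg: "ancestral A \<Longrightarrow> power_coeff s \<rho> A n \<ge> 0"
  using sign coeff_negative_multinomial_nonneg coeff_multinomial_nonneg by (auto elim!: Nats_cases)

text \<open>
  For \<open>s = 1\<close>, the difference between \<open>\<rho>\<close> and the total count of the parents is the number of trials left
  to their child; counts of positive probability do not exhaust more than there are.
\<close>
lemma coeff_sum_parents_le: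
  assumes "ancestral A" "power_coeff s \<rho> A n \<noteq> 0" "s = 1" "i \<in> V" "parents D i \<subseteq> A"
  shows "real (\<Sum>j\<in>parents D i. n j) \<le> \<rho>"
proof -
  obtain m where "\<rho> = real m" using sign assms(3) by (auto elim!: Nats_cases)
  moreover have "parents D i \<in> cliques V E"
    using family_clique[OF assms(4)] by (auto simp: cliques_def)
  ultimately show ?thesis
    using coeff_multinomial_clique_le[OF assms(1), of m n] assms by (simp del: of_nat_sum)
qed

lemma mass_nonneg: "ancestral A \<Longrightarrow> x \<in> params s A \<Longrightarrow> mass A x n \<ge> 0"
  unfolding mass_def by (auto simp: params_def pw_pos PiE_def Pi_def less_imp_le intro!: mult_nonneg_nonneg coeff_nonneg prod_nonneg)

lemma mass_eq_0_iff: "x \<in> params s A \<Longrightarrow> finite A \<Longrightarrow> mass A x n = 0 \<longleftrightarrow> power_coeff s \<rho> A n = 0"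
  unfolding mass_def by (auto simp: params_def pw_pos PiE_def Pi_def)

lemma mass_cong: 
  assumes "ancestral A" "\<And>j. j \<in> A \<Longrightarrow> n j = n' j"
  shows "mass A x n = mass A x n'"
proof -
  have "(\<Prod>i\<in>A. x i ^ n i) = (\<Prod>i\<in>A. x i ^ n' i)" by (rule prod.cong) (auto simp: assms(2))
  then show ?thesis using coeff_cong[OF assms] by (simp add: mass_def)
qed

text \<open>
  Each count of a parent contributes a factor \<open>1 + s * x i\<close>, as \<^const>\<open>eliminate\<close> divides by it, and the
  normalising factor contributes its power with exponent \<open>- \<rho>\<close>.
\<close>
lemma mass_insert:
  assumes anc: "ancestral B" "ancestral (insert i B)" "i \<notin> B" and x: "x \<in> params s (insert i B)"
  shows "mass (insert i B) x n =
    mass B (eliminate s i B x) n * cond_mass (x i) (\<Sum>j\<in>parents D i. n j) (n i)"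
proof -
  let ?Q = "parents D i" and ?x' = "eliminate s i B x" and ?t = "1 + s * x i"
  have fin: "finite B" by (rule ancestral_finite) fact
  have "x i > 0 \<and> ?t > 0 \<and> ?x' \<in> params s B"
    using params_insert_iff[OF anc s_cases, of x] x by (auto simp: params_def PiE_def)
  then have t: "?t > 0" and PB: "P B ?x' > 0" by (auto simp: params_def)
  have "P (insert i B) x = ?t * P B ?x'"
    by (rule stable_poly_eliminate(1)[OF anc]) (use t in auto)
  then have pw: "pw (P (insert i B) x) = ?t powr (- \<rho>) * pw (P B ?x')"
    using t PB by (simp add: pw_pos powr_mult)
  have "(\<Prod>j\<in>B. x j ^ n j) = (\<Prod>j\<in>B. ?x' j ^ n j * (if j \<in> ?Q then ?t ^ n j else 1))"
    using t by (intro prod.cong) (auto simp: eliminate_def power_divide)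
  also have "\<dots> = (\<Prod>j\<in>B. ?x' j ^ n j) * ?t ^ (\<Sum>j\<in>?Q. n j)"
    using sink_parents[OF anc(2,3)] fin
    by (simp add: prod.distrib prod.If_cases Int_absorb1 power_sum)
  also have "?t ^ (\<Sum>j\<in>?Q. n j) = ?t powr real (\<Sum>j\<in>?Q. n j)"
    using t by (rule powr_realpow[symmetric])
  finally have "(\<Prod>j\<in>B. x j ^ n j) = (\<Prod>j\<in>B. ?x' j ^ n j) * ?t powr real (\<Sum>j\<in>?Q. n j)" .
  moreover have "?t powr (real (\<Sum>j\<in>?Q. n j) - \<rho>) = ?t powr real (\<Sum>j\<in>?Q. n j) * ?t powr (- \<rho>)"
    by (simp flip: powr_add)
  ultimately show ?thesis
    using fin anc(3) by (simp add: mass_def cond_mass_def coeff_insert[OF anc(1,3)] pw del: of_nat_sum)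
qed

text \<open>For \<open>s = 1\<close> the series terminates, so that \<open>u\<close> may exceed the radius of convergence.\<close>
lemma binomial_series_sums:
  assumes u: "u > 0" "1 + s * u > 0" and c: "s = 1 \<Longrightarrow> real c \<le> \<rho>"
  shows "(\<lambda>k. ((\<rho> - real c) gchoose k) * (s * u) ^ k) sums (1 + s * u) powr (\<rho> - real c)"
proof (cases "s = 1")
  case True
  then obtain m where m: "\<rho> = real m" using sign by (auto elim!: Nats_cases)
  let ?d = "m - c"
  have d: "\<rho> - real c = real ?d" using m c True by simp
  have "(\<Sum>k\<le>?d. (real ?d gchoose k) * (s * u) ^ k) = (1 + s * u) ^ ?d"
    using binomial_ring[of "s * u" 1 ?d] by (simp add: binomial_gbinomial add.commute)
  also have "\<dots> = (1 + s * u) powr real ?d" using u by (simp add: powr_realpow)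
  finally have "(\<Sum>k\<le>?d. (real ?d gchoose k) * (s * u) ^ k) = (1 + s * u) powr real ?d" .
  moreover have "(\<lambda>k. (real ?d gchoose k) * (s * u) ^ k) sums (\<Sum>k\<le>?d. (real ?d gchoose k) * (s * u) ^ k)"
    by (rule sums_finite) (auto simp flip: binomial_gbinomial)
  ultimately show ?thesis unfolding d by simp
next
  case False
  then have "\<bar>s * u\<bar> < 1" using s_cases u by auto
  then show ?thesis using gen_binomial_real[of "s * u" "\<rho> - real c"] by simp
qed

lemma cond_mass_nonneg:
  assumes u: "u > 0" and c: "s = 1 \<Longrightarrow> real c \<le> \<rho>"
  shows "cond_mass u c k \<ge> 0"
proof (cases "s = 1")
  case True
  then obtain m where m: "\<rho> = real m" using sign by (auto elim!: Nats_cases)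
  have "\<rho> - real c = real (m - c)" using m c True by simp
  then show ?thesis
    using u True unfolding cond_mass_def by (simp flip: binomial_gbinomial)
next
  case False
  then have "s = - 1" "\<rho> < 0" using sign by auto
  then have "s ^ k * ((\<rho> - real c) gchoose k) = pochhammer (real c - \<rho>) k / fact k"
    by (simp add: gbinomial_pochhammer flip: power_add)
  then show ?thesis
    using u \<open>\<rho> < 0\<close> unfolding cond_mass_def by (simp add: pochhammer_nonneg)
qed

lemma cond_mass_total:
  assumes u: "u > 0" "1 + s * u > 0" and c: "s = 1 \<Longrightarrow> real c \<le> \<rho>"
  shows "(\<integral>\<^sup>+k. ennreal (cond_mass u c k) \<partial>count_space UNIV) = 1"
proof -
  have "(1 + s * u) powr (\<rho> - real c) * (1 + s * u) powr (real c - \<rho>) = 1"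
    using u by (simp flip: powr_add)
  then have "cond_mass u c sums 1"
    using sums_mult2[OF binomial_series_sums[OF assms], of "(1 + s * u) powr (real c - \<rho>)"]
    unfolding cond_mass_def by (simp add: power_mult_distrib ac_simps)
  then show ?thesis
    using cond_mass_nonneg[OF u(1) c]
    by (simp add: nn_integral_count_space_nat suminf_ennreal_eq[of "cond_mass u c" 1] sums_unique[symmetric])
qed

lemma space_law: "space (law A x) = A \<rightarrow>\<^sub>E UNIV"
  by (simp add: law_def)

lemma emeasure_law_insert:
  assumes anc: "ancestral B" "ancestral (insert i B)" "i \<notin> B" and x: "x \<in> params s (insert i B)"
  defines "x' \<equiv> eliminate s i B x"
  shows "emeasure (law (insert i B) x) {m \<in> insert i B \<rightarrow>\<^sub>E UNIV. restrict m B \<in> X \<and> m i \<in> Y} =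
    (\<integral>\<^sup>+n. ennreal (mass B x' n) * indicator X n *
      (\<integral>\<^sup>+k. ennreal (cond_mass (x i) (\<Sum>j\<in>parents D i. n j) k) * indicator Y k \<partial>count_space UNIV)
      \<partial>count_space (B \<rightarrow>\<^sub>E UNIV))"
proof -
  let ?A = "insert i B"
  let ?Z = "{m \<in> ?A \<rightarrow>\<^sub>E (UNIV :: nat set). restrict m B \<in> X \<and> m i \<in> Y}"
  let ?c = "\<lambda>n. \<Sum>j\<in>parents D i. n j :: nat"
  have x': "x' \<in> params s B"
    using params_insert_iff[OF anc s_cases, of x] x by (auto simp: params_def PiE_def x'_def)
  have bij: "bij_betw (\<lambda>(n, k). n(i := k)) ((B \<rightarrow>\<^sub>E UNIV) \<times> UNIV) (?A \<rightarrow>\<^sub>E (UNIV :: nat set))"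
    by (rule bij_betw_byWitness[where f' = "\<lambda>m. (restrict m B, m i)"])
      (use anc(3) in \<open>auto simp: fun_eq_iff PiE_def extensional_def restrict_def\<close>)
  have "emeasure (law ?A x) ?Z = (\<integral>\<^sup>+m. ennreal (mass ?A x m) * indicator ?Z m \<partial>count_space (?A \<rightarrow>\<^sub>E UNIV))"
    unfolding law_def by (subst emeasure_density) auto
  also have "\<dots> = (\<integral>\<^sup>+p. ennreal (mass ?A x ((fst p)(i := snd p))) * indicator ?Z ((fst p)(i := snd p))
      \<partial>count_space ((B \<rightarrow>\<^sub>E UNIV) \<times> UNIV))"
    by (subst nn_integral_bij_count_space[OF bij, symmetric]) (simp add: case_prod_beta)
  also have "\<dots> = (\<integral>\<^sup>+p. ennreal (mass ?A x ((fst p)(i := snd p))) * indicator ?Z ((fst p)(i := snd p))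
      \<partial>(count_space (B \<rightarrow>\<^sub>E UNIV) \<Otimes>\<^sub>M count_space UNIV))"
    using ancestral_finite[OF anc(1)] by (subst pair_measure_countable) (auto intro: countable_PiE)
  also have "\<dots> = (\<integral>\<^sup>+n. \<integral>\<^sup>+k. ennreal (mass ?A x (n(i := k))) * indicator ?Z (n(i := k))
      \<partial>count_space UNIV \<partial>count_space (B \<rightarrow>\<^sub>E UNIV))"
  proof -
    interpret sigma_finite_measure "count_space (UNIV :: nat set)"
      by (rule sigma_finite_measure_count_space)
    show ?thesis
      using ancestral_finite[OF anc(1)]
      by (subst nn_integral_fst[symmetric])
        (auto simp: pair_measure_countable countable_PiE)
  qed
  also have "\<dots> = (\<integral>\<^sup>+n. ennreal (mass B x' n) * indicator X n *
      (\<integral>\<^sup>+k. ennreal (cond_mass (x i) (?c n) k) * indicator Y k \<partial>count_space UNIV) \<partial>count_space (B \<rightarrow>\<^sub>E UNIV))"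
  proof (rule nn_integral_cong)
    fix n assume "n \<in> space (count_space (B \<rightarrow>\<^sub>E (UNIV :: nat set)))"
    then have n: "n \<in> B \<rightarrow>\<^sub>E UNIV" by simp
    have "ennreal (mass ?A x (n(i := k))) * indicator ?Z (n(i := k)) =
        ennreal (mass B x' n) * indicator X n * (ennreal (cond_mass (x i) (?c n) k) * indicator Y k)" for k
    proof -
      have "?c (n(i := k)) = ?c n"
        using not_parent_self[of i] by (intro sum.cong) auto
      moreover have "mass B x' (n(i := k)) = mass B x' n"
        using anc(3) by (intro mass_cong[OF anc(1)]) auto
      moreover have "restrict (n(i := k)) B = n"
        using n anc(3) by (auto simp: fun_eq_iff PiE_def extensional_def restrict_def)
      moreover have "n(i := k) \<in> ?A \<rightarrow>\<^sub>E UNIV"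
        using n by (auto simp: PiE_def extensional_def)
      ultimately show ?thesis
        using mass_insert[OF anc x, of "n(i := k)"] mass_nonneg[OF anc(1) x', of n]
        by (simp add: ennreal_mult' indicator_def flip: x'_def)
    qed
    then show "(\<integral>\<^sup>+k. ennreal (mass ?A x (n(i := k))) * indicator ?Z (n(i := k)) \<partial>count_space UNIV) =
      ennreal (mass B x' n) * indicator X n *
      (\<integral>\<^sup>+k. ennreal (cond_mass (x i) (?c n) k) * indicator Y k \<partial>count_space UNIV)"
      by (simp add: nn_integral_cmult)
  qed
  finally show ?thesis .
qed

lemma emeasure_law_eliminate:
  assumes anc: "ancestral B" "ancestral (insert i B)" "i \<notin> B" and x: "x \<in> params s (insert i B)"
    and X: "X \<subseteq> B \<rightarrow>\<^sub>E UNIV"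
  shows "emeasure (law (insert i B) x) {m \<in> insert i B \<rightarrow>\<^sub>E UNIV. restrict m B \<in> X} =
    emeasure (law B (eliminate s i B x)) X"
proof -
  let ?x' = "eliminate s i B x" and ?c = "\<lambda>n. \<Sum>j\<in>parents D i. n j :: nat"
  have x': "x i > 0" "1 + s * x i > 0" "?x' \<in> params s B"
    using params_insert_iff[OF anc s_cases, of x] x by (auto simp: params_def PiE_def)
  have "i \<in> V" using anc(2) by (auto simp: ancestral_def)
  have "ennreal (mass B ?x' n) * indicator X n *
      (\<integral>\<^sup>+k. ennreal (cond_mass (x i) (?c n) k) * indicator UNIV k \<partial>count_space UNIV) =
      ennreal (mass B ?x' n) * indicator X n" for n
  proof (cases "mass B ?x' n = 0")
    case False
    then have "power_coeff s \<rho> B n \<noteq> 0" using mass_eq_0_iff[OF x'(3) ancestral_finite[OF anc(1)]] by blast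
    then have "s = 1 \<Longrightarrow> real (?c n) \<le> \<rho>"
      using coeff_sum_parents_le[OF anc(1) _ _ \<open>i \<in> V\<close> sink_parents[OF anc(2,3)]] by blast
    then show ?thesis using cond_mass_total[OF x'(1,2), of "?c n"] by (simp del: of_nat_sum)
  qed simp
  then show ?thesis
    using emeasure_law_insert[OF anc x, of X UNIV] X
    by (simp add: law_def emeasure_density del: of_nat_sum)
qed

lemma emeasure_law_family:
  assumes anc: "ancestral B" "ancestral (insert i B)" "i \<notin> B" and x: "x \<in> params s (insert i B)"
    and X: "X \<subseteq> B \<rightarrow>\<^sub>E UNIV" "\<And>n. n \<in> X \<Longrightarrow> (\<Sum>j\<in>parents D i. n j) = c"
  shows "emeasure (law (insert i B) x) {m \<in> insert i B \<rightarrow>\<^sub>E UNIV. restrict m B \<in> X \<and> m i = k} =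
    ennreal (cond_mass (x i) c k) * emeasure (law B (eliminate s i B x)) X"
proof -
  have sing: "(\<integral>\<^sup>+l. f l * indicator {k} l \<partial>count_space UNIV) = f k" for f :: "nat \<Rightarrow> ennreal"
    by (subst nn_integral_count_space'[of "{k}"]) auto
  have "emeasure (law (insert i B) x) {m \<in> insert i B \<rightarrow>\<^sub>E UNIV. restrict m B \<in> X \<and> m i \<in> {k}} =
    (\<integral>\<^sup>+n. ennreal (cond_mass (x i) c k) * (ennreal (mass B (eliminate s i B x) n) * indicator X n)
      \<partial>count_space (B \<rightarrow>\<^sub>E UNIV))"
    unfolding emeasure_law_insert[OF anc x, of X "{k}"] sing
    using X(2) by (intro nn_integral_cong) (auto simp: indicator_def mult.commute)
  then show ?thesis
    using X(1) by (simp add: law_def emeasure_density nn_integral_cmult)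
qed

lemma params_empty: "params s {} = {\<lambda>_. undefined}"
  by (auto simp: params_def stable_poly_empty)

lemma prob_space_law:
  assumes "ancestral A" "x \<in> params s A"
  shows "prob_space (law A x)"
  using ancestral_empty assms(1) empty_subsetI assms(2)
proof (induction arbitrary: x rule: ancestral_induct)
  case base
  have "{} \<rightarrow>\<^sub>E (UNIV :: nat set) = {\<lambda>_. undefined}" by auto
  then show ?case
    by (intro prob_spaceI)
      (simp add: law_def emeasure_density mass_def power_coeff_def stable_poly_empty pw_pos nn_integral_count_space_finite)
next
  case (sink i B)
  have "eliminate s i B x \<in> params s B"
    using params_insert_iff[OF sink(1,2,4) s_cases, of x] sink.prems by (auto simp: params_def PiE_def)
  then have "emeasure (law B (eliminate s i B x)) (B \<rightarrow>\<^sub>E UNIV) = 1"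
    using prob_space.emeasure_space_1[OF sink.IH] by (simp add: space_law)
  moreover have "{m \<in> insert i B \<rightarrow>\<^sub>E UNIV. restrict m B \<in> B \<rightarrow>\<^sub>E UNIV} = insert i B \<rightarrow>\<^sub>E (UNIV :: nat set)"
    by auto
  ultimately show ?case
    using emeasure_law_eliminate[OF sink(1,2,4) sink.prems, of "B \<rightarrow>\<^sub>E UNIV"]
    by (intro prob_spaceI) (simp add: space_law)
qed

lemma marginal_law_eliminate:
  assumes anc: "ancestral B" "ancestral (insert i B)" "i \<notin> B" and x: "x \<in> params s (insert i B)"
    and S: "S \<subseteq> B"
  shows "marginal_prob (law (insert i B) x) S n = marginal_prob (law B (eliminate s i B x)) S n"
proof -
  let ?X = "{m \<in> B \<rightarrow>\<^sub>E UNIV. restrict m S = restrict n S}"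
  have "restrict (restrict m B) S = restrict m S" for m :: "'a \<Rightarrow> nat"
    using S by (auto simp: restrict_def fun_eq_iff)
  then have "{m \<in> insert i B \<rightarrow>\<^sub>E UNIV. restrict m S = restrict n S} =
      {m \<in> insert i B \<rightarrow>\<^sub>E UNIV. restrict m B \<in> ?X}" by auto
  then show ?thesis
    using emeasure_law_eliminate[OF anc x, of ?X]
    unfolding marginal_prob_def space_law measure_def by simp
qed

text \<open>
  Given the counts on \<open>B\<close>, the distribution of \<open>N\<^sub>i\<close> involves only those of the parents, and these
  are fixed by \<open>n\<close>. The maximum with \<open>0\<close> is the effect of \<^const>\<open>ennreal\<close> on negative numbers.
\<close>
lemma marginal_law_family:
  assumes anc: "ancestral B" "ancestral (insert i B)" "i \<notin> B" and x: "x \<in> params s (insert i B)"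
  defines "Q \<equiv> parents D i"
  assumes nz: "marginal_prob (law (insert i B) x) Q n \<noteq> 0"
  shows "marginal_prob (law (insert i B) x) (Q \<union> {i}) n / marginal_prob (law (insert i B) x) Q n =
    max 0 (cond_mass (x i) (\<Sum>j\<in>Q. n j) (n i))"
proof -
  let ?X = "{m \<in> B \<rightarrow>\<^sub>E UNIV. restrict m Q = restrict n Q}"
  have QB: "Q \<subseteq> B" unfolding Q_def by (rule sink_parents) fact+
  have rQ: "restrict m Q = restrict n Q \<longleftrightarrow> (\<forall>j\<in>Q. m j = n j)" for m :: "'a \<Rightarrow> nat"
    by (auto simp: restrict_def fun_eq_iff)
  have rQi: "restrict m (Q \<union> {i}) = restrict n (Q \<union> {i}) \<longleftrightarrow> (\<forall>j\<in>Q. m j = n j) \<and> m i = n i" for m :: "'a \<Rightarrow> nat"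
    by (auto simp: restrict_def fun_eq_iff)
  have "{m \<in> insert i B \<rightarrow>\<^sub>E UNIV. restrict m (Q \<union> {i}) = restrict n (Q \<union> {i})} =
      {m \<in> insert i B \<rightarrow>\<^sub>E UNIV. restrict m B \<in> ?X \<and> m i = n i}"
    using QB unfolding rQ rQi by auto
  moreover have "(\<Sum>j\<in>Q. m j) = (\<Sum>j\<in>Q. n j)" if "m \<in> ?X" for m
    using that unfolding rQ by (intro sum.cong) auto
  ultimately have "marginal_prob (law (insert i B) x) (Q \<union> {i}) n =
      enn2real (ennreal (cond_mass (x i) (\<Sum>j\<in>Q. n j) (n i))) * marginal_prob (law B (eliminate s i B x)) Q n"
    using emeasure_law_family[OF anc x, of ?X "\<Sum>j\<in>Q. n j" "n i"]
    unfolding marginal_prob_def space_law measure_def Q_def by (simp add: enn2real_mult)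
  then show ?thesis
    using nz marginal_law_eliminate[OF anc x QB, of n]
    by (cases "cond_mass (x i) (\<Sum>j\<in>Q. n j) (n i) \<ge> 0") (simp_all add: ennreal_neg max_def)
qed

text \<open>
  Which counts have positive probability is decided by the coefficients alone, hence does not depend
  on the parameter.
\<close>
lemma marginal_law_nonzero:
  assumes "ancestral A" "x \<in> params s A" "y \<in> params s A" "marginal_prob (law A x) S n \<noteq> 0"
  shows "marginal_prob (law A y) S n \<noteq> 0"
proof -
  let ?X = "{m \<in> A \<rightarrow>\<^sub>E UNIV. restrict m S = restrict n S}"
  have fin: "finite A" by (rule ancestral_finite) fact
  have eq: "emeasure (law A z) ?X = (\<integral>\<^sup>+m. ennreal (mass A z m) * indicator ?X m \<partial>count_space (A \<rightarrow>\<^sub>E UNIV))" for z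
    unfolding law_def by (subst emeasure_density) auto
  have iff: "emeasure (law A z) ?X = 0 \<longleftrightarrow> (\<forall>m\<in>?X. power_coeff s \<rho> A m = 0)" if z: "z \<in> params s A" for z
  proof -
    have "ennreal (mass A z m) = 0 \<longleftrightarrow> power_coeff s \<rho> A m = 0" for m
      using mass_nonneg[OF assms(1) z, of m] mass_eq_0_iff[OF z fin, of m] by (simp add: ennreal_eq_0_iff)
    then show ?thesis
      unfolding eq by (subst nn_integral_0_iff_AE) (auto simp: AE_count_space indicator_def)
  qed
  have "emeasure (law A z) ?X \<noteq> \<infinity>" if "z \<in> params s A" for z
  proof -
    interpret prob_space "law A z" by (rule prob_space_law[OF assms(1) that])
    show ?thesis by simp
  qed
  then show ?thesis
    using assms(4) iff[OF assms(2)] iff[OF assms(3)] assms(3)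
    unfolding marginal_prob_def space_law measure_def by (auto simp: enn2real_eq_0_iff)
qed

end


section \<open>Eliminating a sink under the prior\<close>

lemma nn_integral_PiM_lborel_scale:
  fixes c :: "'a \<Rightarrow> real"
  assumes "finite J" "\<And>j. j \<in> J \<Longrightarrow> c j > 0" "g \<in> borel_measurable (\<Pi>\<^sub>M j\<in>J. lborel)"
  shows "(\<integral>\<^sup>+z. g z \<partial>(\<Pi>\<^sub>M j\<in>J. lborel)) =
    ennreal (\<Prod>j\<in>J. c j) * (\<integral>\<^sup>+z. g (\<lambda>j\<in>J. c j * z j) \<partial>(\<Pi>\<^sub>M j\<in>J. lborel))"
  using assms
proof (induction J arbitrary: g rule: finite_induct)
  case empty
  have "(\<lambda>z. g (\<lambda>j\<in>{}. c j * z j)) = (\<lambda>z. g (\<lambda>_. undefined))" by (simp add: restrict_def)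
  moreover have "(\<integral>\<^sup>+z. g z \<partial>(\<Pi>\<^sub>M j\<in>{}. lborel)) = (\<integral>\<^sup>+z. g (\<lambda>_. undefined) \<partial>(\<Pi>\<^sub>M j\<in>{}. lborel))"
    using nn_integral_cong[of "\<Pi>\<^sub>M j\<in>{}. lborel" g "\<lambda>_. g (\<lambda>_. undefined)"] by (simp add: space_PiM)
  ultimately show ?case by simp
next
  case (insert i J)
  interpret product_sigma_finite "\<lambda>_::'a. lborel :: real measure" by unfold_locales
  let ?MJ = "\<Pi>\<^sub>M j\<in>J. (lborel :: real measure)"
  note [measurable] = insert.prems(2)
  have ci: "c i > 0" using insert.prems by simp
  have add: "(\<lambda>(z, y). z(i := a * y)) \<in> measurable (?MJ \<Otimes>\<^sub>M lborel) (\<Pi>\<^sub>M j\<in>insert i J. lborel)" for a :: real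
  proof -
    have "(\<lambda>p. (fst p)(i := a * snd p)) =
        (\<lambda>(z, y). z(i := y)) \<circ> (\<lambda>p::('a \<Rightarrow> real) \<times> real. (fst p, a * snd p))"
      by (simp add: fun_eq_iff)
    also have "\<dots> \<in> measurable (?MJ \<Otimes>\<^sub>M lborel) (\<Pi>\<^sub>M j\<in>insert i J. lborel)"
      by (rule measurable_comp[OF _ measurable_add_dim]) measurable
    finally show ?thesis by (simp add: case_prod_beta)
  qed
  have gm: "(\<lambda>(z, y). g (z(i := a * y))) \<in> borel_measurable (?MJ \<Otimes>\<^sub>M lborel)" for a :: real
    using measurable_compose[OF add insert.prems(2)] by (simp add: case_prod_beta)
  let ?G = "\<lambda>z. \<integral>\<^sup>+y. g (z(i := c i * y)) \<partial>lborel"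
  have G: "?G \<in> borel_measurable ?MJ"
    using lborel.borel_measurable_nn_integral[OF gm] .
  have sc: "(\<lambda>z. g (\<lambda>j\<in>insert i J. c j * z j)) \<in> borel_measurable (\<Pi>\<^sub>M j\<in>insert i J. lborel)"
    by measurable
  have "(\<integral>\<^sup>+z. g z \<partial>(\<Pi>\<^sub>M j\<in>insert i J. lborel)) = (\<integral>\<^sup>+z. (\<integral>\<^sup>+y. g (z(i := y)) \<partial>lborel) \<partial>?MJ)"
    by (rule product_nn_integral_insert) (use insert in auto)
  also have "\<dots> = (\<integral>\<^sup>+z. ennreal (c i) * ?G z \<partial>?MJ)"
  proof (rule nn_integral_cong)
    fix z assume z: "z \<in> space ?MJ"
    have "(\<lambda>y. g (z(i := y))) \<in> borel_measurable lborel"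
      using measurable_Pair2[OF gm[of 1], OF z] by simp
    then show "(\<integral>\<^sup>+y. g (z(i := y)) \<partial>lborel) = ennreal (c i) * ?G z"
      using nn_integral_real_affine[of "\<lambda>y. g (z(i := y))" "c i" 0] ci by simp
  qed
  also have "\<dots> = ennreal (c i) * (\<integral>\<^sup>+z. ?G z \<partial>?MJ)"
    using G by (rule nn_integral_cmult)
  also have "(\<integral>\<^sup>+z. ?G z \<partial>?MJ) = ennreal (\<Prod>j\<in>J. c j) * (\<integral>\<^sup>+z. ?G (\<lambda>j\<in>J. c j * z j) \<partial>?MJ)"
    by (rule insert.IH[OF _ G]) (use insert.prems in auto)
  also have "(\<integral>\<^sup>+z. ?G (\<lambda>j\<in>J. c j * z j) \<partial>?MJ) =
      (\<integral>\<^sup>+z. (\<integral>\<^sup>+y. g (\<lambda>j\<in>insert i J. c j * (z(i := y)) j) \<partial>lborel) \<partial>?MJ)"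
  proof -
    have "(\<lambda>j\<in>J. c j * z j)(i := c i * y) = (\<lambda>j\<in>insert i J. c j * (z(i := y)) j)" for z y
      using insert.hyps by (auto simp: fun_eq_iff restrict_def)
    then show ?thesis by simp
  qed
  also have "\<dots> = (\<integral>\<^sup>+z. g (\<lambda>j\<in>insert i J. c j * z j) \<partial>(\<Pi>\<^sub>M j\<in>insert i J. lborel))"
    by (rule product_nn_integral_insert[symmetric]) (use insert sc in auto)
  finally have eq: "(\<integral>\<^sup>+z. g z \<partial>(\<Pi>\<^sub>M j\<in>insert i J. lborel)) = ennreal (c i) * (ennreal (\<Prod>j\<in>J. c j) *
      (\<integral>\<^sup>+z. g (\<lambda>j\<in>insert i J. c j * z j) \<partial>(\<Pi>\<^sub>M j\<in>insert i J. lborel)))" .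
  have "ennreal (\<Prod>j\<in>insert i J. c j) = ennreal (c i) * ennreal (\<Prod>j\<in>J. c j)"
    using insert.hyps insert.prems(1) by (simp add: ennreal_mult prod_nonneg less_imp_le)
  then show ?case unfolding eq by (simp only: mult.assoc)
qed

lemma stable_poly_measurable [measurable]:
  assumes "finite A" "S \<subseteq> A"
  shows "stable_poly s E S \<in> borel_measurable (\<Pi>\<^sub>M j\<in>A. (lborel :: real measure))"
proof -
  have "(\<lambda>x. x j) \<in> borel_measurable (\<Pi>\<^sub>M j\<in>A. (lborel :: real measure))" if "j \<in> C" "C \<in> stable_sets E S" for j C
  proof -
    have "j \<in> A" using that assms(2) by (auto simp: stable_sets_def)
    then show ?thesis using measurable_component_singleton[of j A "\<lambda>_. lborel"] by simp
  qed
  then show ?thesis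
    unfolding stable_poly_def[abs_def] by (intro borel_measurable_sum borel_measurable_times borel_measurable_prod) auto
qed

context graph_model
begin

definition weight :: "'a set \<Rightarrow> ('a \<Rightarrow> real) \<Rightarrow> real" where
  "weight A x = P A x powr \<gamma> * (\<Prod>i\<in>A. x i powr (\<alpha> i - 1)) * indicator (params s A) x"

definition prior :: "'a set \<Rightarrow> ('a \<Rightarrow> real) measure" where
  "prior A = prob_density (\<Pi>\<^sub>M i\<in>A. lborel) (weight A)"

text \<open>
  An unnormalised beta density: of the first kind on the unit interval for \<open>s = - 1\<close>, and of the
  second kind on the half-line for \<open>s = 1\<close>.
\<close>
definition sink_weight :: "'a \<Rightarrow> real \<Rightarrow> real" where
  "sink_weight i u = u powr (\<alpha> i - 1) * (1 + s * u) powr (\<gamma> + (\<Sum>j\<in>parents D i. \<alpha> j)) *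
    indicator {u. u > 0 \<and> 1 + s * u > 0} u"

definition sink_prior :: "'a \<Rightarrow> real measure" where
  "sink_prior i = prob_density lborel (sink_weight i)"

lemma weight_nonneg: "weight A x \<ge> 0" and sink_weight_nonneg: "sink_weight i u \<ge> 0"
  by (simp_all add: weight_def sink_weight_def prod_nonneg)

lemma sink_weight_measurable [measurable]: "sink_weight i \<in> borel_measurable borel"
  unfolding sink_weight_def[abs_def] by measurable

lemma params_measurable [measurable]:
  assumes "finite A" shows "params s A \<in> sets (\<Pi>\<^sub>M j\<in>A. lborel)"
proof -
  have [measurable]: "(\<lambda>x. x j) \<in> borel_measurable (\<Pi>\<^sub>M j\<in>A. (lborel :: real measure))" if "j \<in> A" for j
    using measurable_component_singleton[of j A "\<lambda>_. lborel", OF that] by simp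
  have "params s A = {x \<in> space (\<Pi>\<^sub>M j\<in>A. lborel). (\<forall>j\<in>A. x j > 0) \<and> (\<forall>S\<in>Pow A. P S x > 0)}"
    by (auto simp: params_def space_PiM PiE_def)
  also have "\<dots> \<in> sets (\<Pi>\<^sub>M j\<in>A. lborel)"
    using assms by (intro sets.sets_Collect_conj sets.sets_Collect_finite_All borel_measurable_less) auto
  finally show ?thesis .
qed

lemma weight_measurable [measurable]:
  assumes "finite A" shows "weight A \<in> borel_measurable (\<Pi>\<^sub>M j\<in>A. lborel)"
proof -
  have [measurable]: "(\<lambda>x. x j) \<in> borel_measurable (\<Pi>\<^sub>M j\<in>A. (lborel :: real measure))" if "j \<in> A" for j
    using measurable_component_singleton[of j A "\<lambda>_. lborel", OF that] by simp
  note [measurable] = stable_poly_measurable[OF assms subset_refl] params_measurable[OF assms]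
  have "(\<lambda>x. \<Prod>i\<in>A. x i powr (\<alpha> i - 1)) \<in> borel_measurable (\<Pi>\<^sub>M j\<in>A. lborel)"
    by (intro borel_measurable_prod) auto
  then show ?thesis
    unfolding weight_def[abs_def] by measurable
qed

lemma eliminate_measurable:
  assumes "ancestral (insert i B)" "i \<notin> B"
  shows "eliminate s i B \<in> measurable (\<Pi>\<^sub>M j\<in>insert i B. lborel) (\<Pi>\<^sub>M j\<in>B. lborel)"
  unfolding eliminate_def[abs_def]
proof (rule measurable_restrict)
  fix j assume "j \<in> B"
  have [measurable]: "(\<lambda>x. x k) \<in> borel_measurable (\<Pi>\<^sub>M j\<in>insert i B. (lborel :: real measure))" if "k \<in> insert i B" for k
    using measurable_component_singleton[of k "insert i B" "\<lambda>_. lborel", OF that] by simp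
  show "(\<lambda>x. if j \<in> parents D i then x j / (1 + s * x i) else x j) \<in> (\<Pi>\<^sub>M j\<in>insert i B. lborel) \<rightarrow>\<^sub>M lborel"
    using \<open>j \<in> B\<close> by (cases "j \<in> parents D i") simp_all
qed

text \<open>
  The vector \<open>x\<close> is the preimage of \<open>(u, z)\<close> under elimination, and the factor
  \<open>(1 + s * u) ^ card (parents D i)\<close> is the Jacobian of this change of variables. The powers of \<open>1 + s * u\<close>
  produced by \<open>P\<close>, by the coordinates of the parents and by the Jacobian depend on \<open>u\<close> only.
\<close>
lemma weight_insert:
  assumes anc: "ancestral B" "ancestral (insert i B)" "i \<notin> B"
    and z: "z \<in> B \<rightarrow>\<^sub>E UNIV" and u: "u > 0" "1 + s * u > 0"
  defines "x \<equiv> (\<lambda>j\<in>B. (if j \<in> parents D i then 1 + s * u else 1) * z j)(i := u)"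
  shows "eliminate s i B x = z"
    and "(1 + s * u) ^ card (parents D i) * weight (insert i B) x = sink_weight i u * weight B z"
proof -
  let ?Q = "parents D i" and ?t = "1 + s * u"
  have fin: "finite B" by (rule ancestral_finite) fact
  have QB: "?Q \<subseteq> B" by (rule sink_parents) fact+
  have xi: "x i = u" by (simp add: x_def)
  have xj: "x j = (if j \<in> ?Q then ?t else 1) * z j" if "j \<in> B" for j
    using that anc(3) by (auto simp: x_def)
  show el: "eliminate s i B x = z"
    using z u xi xj by (auto simp: eliminate_def fun_eq_iff PiE_def extensional_def restrict_def)
  have "x \<in> extensional (insert i B)" by (auto simp: x_def extensional_def)
  then have mem: "x \<in> params s (insert i B) \<longleftrightarrow> z \<in> params s B"
    using params_insert_iff[OF anc s_cases, of x] u by (simp add: xi el)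
  show "?t ^ card ?Q * weight (insert i B) x = sink_weight i u * weight B z"
  proof (cases "z \<in> params s B")
    case True
    then have zpos: "z j > 0" if "j \<in> B" for j using that by (auto simp: params_def)
    have PB: "P B z > 0" using True by (auto simp: params_def)
    have "P (insert i B) x = ?t * P B z"
      using stable_poly_eliminate(1)[OF anc subset_refl, of s x] u by (simp add: xi el)
    then have Pp: "P (insert i B) x powr \<gamma> = ?t powr \<gamma> * P B z powr \<gamma>"
      using u PB by (simp add: powr_mult)
    have "(\<Prod>j\<in>B. x j powr (\<alpha> j - 1)) =
        (\<Prod>j\<in>B. (if j \<in> ?Q then ?t powr (\<alpha> j - 1) else 1) * z j powr (\<alpha> j - 1))"
      using u zpos by (intro prod.cong) (auto simp: xj powr_mult)
    also have "\<dots> = (\<Prod>j\<in>?Q. ?t powr (\<alpha> j - 1)) * (\<Prod>j\<in>B. z j powr (\<alpha> j - 1))"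
      using fin QB by (simp add: prod.distrib prod.If_cases Int_absorb1)
    also have "(\<Prod>j\<in>?Q. ?t powr (\<alpha> j - 1)) = ?t powr ((\<Sum>j\<in>?Q. \<alpha> j) - real (card ?Q))"
      using u finite_parents[of i] by (simp add: powr_sum[symmetric] sum_subtractf)
    finally have pr: "(\<Prod>j\<in>B. x j powr (\<alpha> j - 1)) =
        ?t powr ((\<Sum>j\<in>?Q. \<alpha> j) - real (card ?Q)) * (\<Prod>j\<in>B. z j powr (\<alpha> j - 1))" .
    have "?t ^ card ?Q * (?t powr \<gamma> * ?t powr ((\<Sum>j\<in>?Q. \<alpha> j) - real (card ?Q))) = ?t powr (\<gamma> + (\<Sum>j\<in>?Q. \<alpha> j))"
      using u by (simp add: powr_realpow[symmetric] powr_add[symmetric])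
    then show ?thesis
      using True mem u fin anc(3) unfolding weight_def sink_weight_def
      by (simp add: xi Pp pr ac_simps)
  qed (use mem in \<open>simp add: weight_def\<close>)
qed

lemma nn_integral_weight_insert:
  assumes anc: "ancestral B" "ancestral (insert i B)" "i \<notin> B"
    and g: "g \<in> borel_measurable (lborel \<Otimes>\<^sub>M (\<Pi>\<^sub>M j\<in>B. lborel))"
  shows "(\<integral>\<^sup>+x. ennreal (weight (insert i B) x) * g (x i, eliminate s i B x) \<partial>(\<Pi>\<^sub>M j\<in>insert i B. lborel)) =
    (\<integral>\<^sup>+u. \<integral>\<^sup>+z. ennreal (sink_weight i u) * ennreal (weight B z) * g (u, z) \<partial>(\<Pi>\<^sub>M j\<in>B. lborel) \<partial>lborel)"
proof -
  interpret product_sigma_finite "\<lambda>_::'a. lborel :: real measure" by unfold_locales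
  let ?MA = "\<Pi>\<^sub>M j\<in>insert i B. (lborel :: real measure)" and ?MB = "\<Pi>\<^sub>M j\<in>B. (lborel :: real measure)"
  have fin: "finite B" by (rule ancestral_finite) fact
  let ?F = "\<lambda>x. ennreal (weight (insert i B) x) * g (x i, eliminate s i B x)"
  have [measurable]: "(\<lambda>x. x i) \<in> ?MA \<rightarrow>\<^sub>M lborel"
    by (rule measurable_component_singleton) simp
  note [measurable] = eliminate_measurable[OF anc(2,3)] weight_measurable[of "insert i B"] weight_measurable[OF fin]
  have "(\<lambda>x. g (x i, eliminate s i B x)) \<in> borel_measurable ?MA"
    by (rule measurable_compose[OF _ g]) measurable
  moreover have "(\<lambda>x. ennreal (weight (insert i B) x)) \<in> borel_measurable ?MA"
    using fin by (intro measurable_compose[OF weight_measurable measurable_ennreal]) auto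
  ultimately have F: "?F \<in> borel_measurable ?MA"
    by (intro borel_measurable_times_ennreal)
  have "(\<integral>\<^sup>+x. ?F x \<partial>?MA) = (\<integral>\<^sup>+u. \<integral>\<^sup>+y. ?F (y(i := u)) \<partial>?MB \<partial>lborel)"
    by (rule product_nn_integral_insert_rev[OF fin anc(3) F])
  also have "\<dots> = (\<integral>\<^sup>+u. \<integral>\<^sup>+z. ennreal (sink_weight i u) * ennreal (weight B z) * g (u, z) \<partial>?MB \<partial>lborel)"
  proof (rule nn_integral_cong)
    fix u :: real
    show "(\<integral>\<^sup>+y. ?F (y(i := u)) \<partial>?MB) = (\<integral>\<^sup>+z. ennreal (sink_weight i u) * ennreal (weight B z) * g (u, z) \<partial>?MB)"
    proof (cases "u > 0 \<and> 1 + s * u > 0")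
      case False
      have "weight (insert i B) (y(i := u)) = 0" for y
        using params_insert_iff[OF anc s_cases, of "y(i := u)"] False
        by (auto simp: weight_def indicator_def params_def PiE_def)
      moreover have "sink_weight i u = 0" using False by (auto simp: sink_weight_def)
      ultimately show ?thesis by simp
    next
      case True
      let ?t = "1 + s * u"
      let ?c = "\<lambda>j. if j \<in> parents D i then ?t else 1"
      have m: "(\<lambda>y. ?F (y(i := u))) \<in> borel_measurable ?MB"
      proof (rule measurable_compose[OF _ F])
        show "(\<lambda>y. y(i := u)) \<in> ?MB \<rightarrow>\<^sub>M ?MA"
          using measurable_compose[OF measurable_Pair2'[of u lborel ?MB] measurable_add_dim[of i B "\<lambda>_. lborel"]]
          by simp
      qed
      have "(\<integral>\<^sup>+y. ?F (y(i := u)) \<partial>?MB) =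
          ennreal (\<Prod>j\<in>B. ?c j) * (\<integral>\<^sup>+z. ?F ((\<lambda>j\<in>B. ?c j * z j)(i := u)) \<partial>?MB)"
        using True by (intro nn_integral_PiM_lborel_scale fin m) auto
      also have "(\<Prod>j\<in>B. ?c j) = ?t ^ card (parents D i)"
        using fin sink_parents[OF anc(2,3)] by (simp add: prod.If_cases Int_absorb1)
      also have "ennreal (?t ^ card (parents D i)) * (\<integral>\<^sup>+z. ?F ((\<lambda>j\<in>B. ?c j * z j)(i := u)) \<partial>?MB) =
          (\<integral>\<^sup>+z. ennreal (?t ^ card (parents D i)) * ?F ((\<lambda>j\<in>B. ?c j * z j)(i := u)) \<partial>?MB)"
      proof (rule nn_integral_cmult[symmetric])
        have "(\<lambda>z. \<lambda>j\<in>B. ?c j * z j) \<in> ?MB \<rightarrow>\<^sub>M ?MB" 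
        proof (rule measurable_restrict)
          fix j assume "j \<in> B"
          then have "(\<lambda>z. z j) \<in> borel_measurable ?MB"
            using measurable_component_singleton[of j B "\<lambda>_. lborel"] by simp
          then show "(\<lambda>z. ?c j * z j) \<in> ?MB \<rightarrow>\<^sub>M lborel" by simp
        qed
        from measurable_compose[OF this m] show "(\<lambda>z. ?F ((\<lambda>j\<in>B. ?c j * z j)(i := u))) \<in> borel_measurable ?MB" .
      qed
      also have "\<dots> = (\<integral>\<^sup>+z. ennreal (sink_weight i u) * ennreal (weight B z) * g (u, z) \<partial>?MB)"
      proof (rule nn_integral_cong)
        fix z assume "z \<in> space ?MB"
        then have z: "z \<in> B \<rightarrow>\<^sub>E UNIV" by (simp add: space_PiM)
        let ?x = "(\<lambda>j\<in>B. ?c j * z j)(i := u)"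
        have "ennreal (?t ^ card (parents D i)) * ennreal (weight (insert i B) ?x) =
            ennreal (sink_weight i u) * ennreal (weight B z)"
          using weight_insert(2)[OF anc z] True
          by (simp add: weight_nonneg sink_weight_nonneg flip: ennreal_mult)
        then show "ennreal (?t ^ card (parents D i)) * ?F ?x =
            ennreal (sink_weight i u) * ennreal (weight B z) * g (u, z)"
          using weight_insert(1)[OF anc z] True by (simp flip: mult.assoc)
      qed
      finally show ?thesis .
    qed
  qed
  finally show ?thesis .
qed

text \<open>
  For \<open>s = - 1\<close> this is the beta integral. For \<open>s = 1\<close> the exponent \<open>c\<close> of \<open>1 + u\<close> is negative, so that
  the density is at most \<open>u powr (\<alpha> i - 1)\<close> below 1 and at most \<open>u powr (\<alpha> i - 1 + c)\<close> above; the latter is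
  integrable because \<open>i\<close> and its parents form a clique, on which \<open>\<gamma>\<close> outweighs the sum of \<open>\<alpha>\<close>.
\<close>
lemma sink_weight_mass_finite:
  assumes "i \<in> V"
  shows "(\<integral>\<^sup>+u. ennreal (sink_weight i u) \<partial>lborel) < \<infinity>"
proof (cases "s = 1")
  case False
  then have s: "s = - 1" "\<gamma> > - 1" using sign by auto
  let ?b = "\<gamma> + (\<Sum>j\<in>parents D i. \<alpha> j) + 1"
  have "(\<Sum>j\<in>parents D i. \<alpha> j) \<ge> 0"
    using parents_V[of i] by (intro sum_nonneg) (auto intro: less_imp_le \<alpha>_pos)
  then have b: "?b > 0" using s by simp
  let ?f = "\<lambda>t. t powr (\<alpha> i - 1) * (1 - t) powr (?b - 1)"
  have "(?f has_integral Beta (\<alpha> i) ?b) {0..1}"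
    by (rule has_integral_Beta_real) (use b \<alpha>_pos assms in auto)
  then have "(\<integral>\<^sup>+u. ennreal (indicator {0..1} u * ?f u) \<partial>lborel) = ennreal (Beta (\<alpha> i) ?b)"
    by (rule nn_integral_has_integral_lebesgue[rotated]) auto
  moreover have "(\<integral>\<^sup>+u. ennreal (sink_weight i u) \<partial>lborel) \<le> (\<integral>\<^sup>+u. ennreal (indicator {0..1} u * ?f u) \<partial>lborel)"
    unfolding sink_weight_def using s(1) by (intro nn_integral_mono ennreal_leI) (auto simp: indicator_def)
  ultimately show ?thesis by (auto simp: less_top[symmetric] top_unique)
next
  case True
  let ?a = "\<alpha> i" and ?c = "\<gamma> + (\<Sum>j\<in>parents D i. \<alpha> j)"
  have a: "?a > 0" using \<alpha>_pos assms .
  have "\<gamma> + (\<Sum>j\<in>insert i (parents D i). \<alpha> j) < 0"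
    using sign True family_clique[OF assms] by auto
  then have ac: "?a + ?c < 0" using finite_parents[of i] not_parent_self[of i] by simp
  have i1: "((\<lambda>x. x powr (?a - 1)) has_integral (1 powr (?a - 1 + 1) / (?a - 1 + 1))) {0..1}"
    by (rule has_integral_powr_from_0) (use a in auto)
  have i2: "((\<lambda>x. x powr (?a - 1 + ?c)) has_integral - (1 powr (?a - 1 + ?c + 1)) / (?a - 1 + ?c + 1)) {1..}"
    by (rule has_integral_powr_to_inf) (use ac in auto)
  have "(\<integral>\<^sup>+u. ennreal (sink_weight i u) \<partial>lborel) \<le>
      (\<integral>\<^sup>+u. ennreal (indicator {0..1} u * u powr (?a - 1)) + ennreal (indicator {1..} u * u powr (?a - 1 + ?c)) \<partial>lborel)"
  proof (intro nn_integral_mono)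
    fix u :: real
    have bound: "sink_weight i u \<le> indicator {0..1} u * u powr (?a - 1) + indicator {1..} u * u powr (?a - 1 + ?c)"
    proof (cases "u > 0")
      case u: True
      show ?thesis
      proof (cases "u \<ge> 1")
        case True
        have "(1 + u) powr ?c \<le> u powr ?c" using u ac a by (intro powr_mono2') auto
        then have "u powr (?a - 1) * (1 + u) powr ?c \<le> u powr (?a - 1) * u powr ?c"
          by (intro mult_left_mono) auto
        also have "\<dots> = u powr (?a - 1 + ?c)" by (simp add: powr_add)
        finally show ?thesis unfolding sink_weight_def using True u \<open>s = 1\<close> by (auto simp: indicator_def)
      next
        case False
        have "(1 + u) powr ?c \<le> 1 powr ?c" using u ac a by (intro powr_mono2') auto
        then have "u powr (?a - 1) * (1 + u) powr ?c \<le> u powr (?a - 1)"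
          by (simp add: mult_left_le)
        then show ?thesis unfolding sink_weight_def using False u \<open>s = 1\<close> by (auto simp: indicator_def)
      qed
    qed (simp add: sink_weight_def)
    then show "ennreal (sink_weight i u) \<le>
        ennreal (indicator {0..1} u * u powr (?a - 1)) + ennreal (indicator {1..} u * u powr (?a - 1 + ?c))"
      by (simp add: ennreal_leI flip: ennreal_plus)
  qed
  also have "\<dots> = (\<integral>\<^sup>+u. ennreal (indicator {0..1} u * u powr (?a - 1)) \<partial>lborel) +
      (\<integral>\<^sup>+u. ennreal (indicator {1..} u * u powr (?a - 1 + ?c)) \<partial>lborel)"
    by (rule nn_integral_add) measurable
  also have "\<dots> < \<infinity>"
    unfolding nn_integral_has_integral_lebesgue[OF _ i1, simplified] nn_integral_has_integral_lebesgue[OF _ i2, simplified]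
    by simp
  finally show ?thesis .
qed

lemma sink_weight_mass_pos: "(\<integral>\<^sup>+u. ennreal (sink_weight i u) \<partial>lborel) > 0"
proof -
  have pos: "sink_weight i u > 0" if "u \<in> {0<..<1}" for u
    using that s_cases by (auto simp: sink_weight_def)
  have "\<not> (AE u in lborel. ennreal (sink_weight i u) = 0)"
  proof
    assume "AE u in lborel. ennreal (sink_weight i u) = 0"
    then have "AE u in lborel. u \<notin> {0<..<1::real}"
    proof eventually_elim
      case (elim u)
      then show ?case using pos[of u] by (force simp: ennreal_eq_0_iff)
    qed
    then have "emeasure lborel {0<..<1::real} = 0"
      by (subst (asm) AE_iff_measurable[of "{0<..<1::real}"]) auto
    then show False by simp
  qed
  then show ?thesis
    by (subst (asm) nn_integral_0_iff_AE[symmetric]) (auto simp: zero_less_iff_neq_zero)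
qed

lemma weight_mass_insert:
  assumes anc: "ancestral B" "ancestral (insert i B)" "i \<notin> B"
  shows "(\<integral>\<^sup>+x. ennreal (weight (insert i B) x) \<partial>(\<Pi>\<^sub>M j\<in>insert i B. lborel)) =
    (\<integral>\<^sup>+u. ennreal (sink_weight i u) \<partial>lborel) * (\<integral>\<^sup>+z. ennreal (weight B z) \<partial>(\<Pi>\<^sub>M j\<in>B. lborel))"
proof -
  note [measurable] = weight_measurable[OF ancestral_finite[OF anc(1)]]
  show ?thesis
    using nn_integral_weight_insert[OF anc, of "\<lambda>_. 1"]
    by (simp add: nn_integral_cmult nn_integral_multc)
qed

lemma weight_mass:
  assumes "ancestral A"
  shows "0 < (\<integral>\<^sup>+x. ennreal (weight A x) \<partial>(\<Pi>\<^sub>M j\<in>A. lborel)) \<and> (\<integral>\<^sup>+x. ennreal (weight A x) \<partial>(\<Pi>\<^sub>M j\<in>A. lborel)) < \<infinity>"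
  using ancestral_empty assms empty_subsetI
proof (induction rule: ancestral_induct)
  case base
  interpret product_sigma_finite "\<lambda>_::'a. lborel :: real measure" by unfold_locales
  have "weight {} (\<lambda>_. undefined) = 1"
    by (simp add: weight_def stable_poly_empty params_empty)
  then show ?case by (simp add: nn_integral_empty)
next
  case (sink i B)
  then have "i \<in> V" by (auto simp: ancestral_def)
  then show ?case
    using sink sink_weight_mass_finite[of i] sink_weight_mass_pos[of i]
    by (simp add: weight_mass_insert ennreal_zero_less_mult_iff ennreal_mult_less_top)
qed

lemma prob_space_prob_density:
  assumes "f \<in> borel_measurable L" "0 < (\<integral>\<^sup>+x. ennreal (f x) \<partial>L)" "(\<integral>\<^sup>+x. ennreal (f x) \<partial>L) < \<infinity>"
  shows "prob_space (prob_density L f)"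
proof
  have "emeasure (prob_density L f) (space (prob_density L f)) =
      (\<integral>\<^sup>+x. ennreal (f x) / (\<integral>\<^sup>+z. ennreal (f z) \<partial>L) \<partial>L)"
    using assms(1) unfolding prob_density_def by (simp add: emeasure_density cong: nn_integral_cong)
  also have "\<dots> = (\<integral>\<^sup>+x. ennreal (f x) \<partial>L) / (\<integral>\<^sup>+z. ennreal (f z) \<partial>L)"
    using assms(1) by (intro nn_integral_divide) simp
  also have "\<dots> = 1"
    using assms(2,3) by (intro ennreal_divide_self) auto
  finally show "emeasure (prob_density L f) (space (prob_density L f)) = 1" .
qed

lemma prob_space_prior: "ancestral A \<Longrightarrow> prob_space (prior A)"
  unfolding prior_def using weight_mass ancestral_finite by (intro prob_space_prob_density weight_measurable) auto

lemma prob_space_sink_prior: "i \<in> V \<Longrightarrow> prob_space (sink_prior i)"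
  unfolding sink_prior_def using sink_weight_mass_finite sink_weight_mass_pos
  by (intro prob_space_prob_density) auto

lemma sets_prior [measurable_cong]: "sets (prior A) = sets (\<Pi>\<^sub>M j\<in>A. lborel)"
  by (simp add: prior_def prob_density_def)

lemma sets_sink_prior [measurable_cong]: "sets (sink_prior i) = sets borel"
  by (simp add: sink_prior_def prob_density_def)

lemma AE_prior: "finite A \<Longrightarrow> AE x in prior A. x \<in> params s A"
  unfolding prior_def prob_density_def
  using weight_measurable[of A] by (subst AE_density) (auto simp: weight_def indicator_def)

text \<open>In the variables \<open>u\<close> and \<open>z\<close> the density factorises by \<open>weight_insert\<close>, and so does the normalising
  constant; dividing by it factor by factor leaves two probability densities.\<close>
lemma distr_prior_eliminate:
  assumes anc: "ancestral B" "ancestral (insert i B)" "i \<notin> B"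
  shows "distr (prior (insert i B)) (borel \<Otimes>\<^sub>M (\<Pi>\<^sub>M j\<in>B. lborel)) (\<lambda>x. (x i, eliminate s i B x)) =
    sink_prior i \<Otimes>\<^sub>M prior B"
proof -
  let ?MA = "\<Pi>\<^sub>M j\<in>insert i B. (lborel :: real measure)" and ?MB = "\<Pi>\<^sub>M j\<in>B. (lborel :: real measure)"
  let ?X = "\<lambda>x. (x i, eliminate s i B x)"
  have fin: "finite B" by (rule ancestral_finite) fact
  have "i \<in> V" using anc by (auto simp: ancestral_def)
  interpret prB: prob_space "prior B" by (rule prob_space_prior) fact
  interpret lB: sigma_finite_measure ?MB
    by (intro product_sigma_finite.sigma_finite fin) unfold_locales
  note [measurable] = eliminate_measurable[OF anc(2,3)] weight_measurable[of "insert i B"] weight_measurable[OF fin]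
  have [measurable]: "(\<lambda>x. x i) \<in> borel_measurable ?MA"
    using measurable_component_singleton[of i "insert i B" "\<lambda>_. lborel"] by simp
  have X: "?X \<in> ?MA \<rightarrow>\<^sub>M (borel \<Otimes>\<^sub>M ?MB)" by measurable
  then have X': "?X \<in> prior (insert i B) \<rightarrow>\<^sub>M (borel \<Otimes>\<^sub>M ?MB)"
    unfolding measurable_cong_sets[OF sets_prior refl] .
  define H where "H = (\<integral>\<^sup>+u. ennreal (sink_weight i u) \<partial>lborel)"
  define Z where "Z = (\<integral>\<^sup>+z. ennreal (weight B z) \<partial>?MB)"
  have ZA: "(\<integral>\<^sup>+x. ennreal (weight (insert i B) x) \<partial>?MA) = H * Z"
    unfolding H_def Z_def by (rule weight_mass_insert) fact+
  have fins: "H < \<infinity>" "Z < \<infinity>"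
    using sink_weight_mass_finite[OF \<open>i \<in> V\<close>] weight_mass[OF anc(1)] by (auto simp: H_def Z_def)
  have dens: "sink_prior i \<Otimes>\<^sub>M prior B =
      density (lborel \<Otimes>\<^sub>M ?MB) (\<lambda>(u, z). ennreal (sink_weight i u) / H * (ennreal (weight B z) / Z))"
    unfolding sink_prior_def prior_def prob_density_def H_def Z_def
  proof (rule pair_measure_density)
    show "sigma_finite_measure (density ?MB (\<lambda>x. ennreal (weight B x) / (\<integral>\<^sup>+z. ennreal (weight B z) \<partial>?MB)))"
      using prB.sigma_finite_measure_axioms by (simp add: prior_def prob_density_def)
  qed (use fin in \<open>auto intro: lB.sigma_finite_measure_axioms\<close>)
  show ?thesis
  proof (rule measure_eqI)
    show "sets (distr (prior (insert i B)) (borel \<Otimes>\<^sub>M ?MB) ?X) = sets (sink_prior i \<Otimes>\<^sub>M prior B)"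
      by (simp cong: sets_pair_measure_cong add: sets_sink_prior sets_prior)
  next
    fix S assume "S \<in> sets (distr (prior (insert i B)) (borel \<Otimes>\<^sub>M ?MB) ?X)"
    then have S: "S \<in> sets (borel \<Otimes>\<^sub>M ?MB)" by simp
    then have S' [measurable]: "S \<in> sets (lborel \<Otimes>\<^sub>M ?MB)" by (simp cong: sets_pair_measure_cong)
    have ind: "(\<lambda>x. indicator S (?X x) :: ennreal) \<in> borel_measurable ?MA"
      by (rule measurable_compose[OF X]) (use S in auto)
    have "emeasure (distr (prior (insert i B)) (borel \<Otimes>\<^sub>M ?MB) ?X) S =
        (\<integral>\<^sup>+p. indicator S p \<partial>distr (prior (insert i B)) (borel \<Otimes>\<^sub>M ?MB) ?X)"
      using S by simp
    also have "\<dots> = (\<integral>\<^sup>+x. indicator S (?X x) \<partial>prior (insert i B))"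
      using X' S by (intro nn_integral_distr) auto
    also have "\<dots> = (\<integral>\<^sup>+x. ennreal (weight (insert i B) x) / (H * Z) * indicator S (?X x) \<partial>?MA)"
      unfolding prior_def prob_density_def ZA
      using fin ind by (subst nn_integral_density) auto
    also have "\<dots> = (\<integral>\<^sup>+x. ennreal (weight (insert i B) x) * (\<lambda>p. inverse (H * Z) * indicator S p) (?X x) \<partial>?MA)"
      by (simp add: divide_ennreal_def ac_simps)
    also have "\<dots> = (\<integral>\<^sup>+u. \<integral>\<^sup>+z. ennreal (sink_weight i u) * ennreal (weight B z) * (inverse (H * Z) * indicator S (u, z)) \<partial>?MB \<partial>lborel)"
      by (rule nn_integral_weight_insert[OF anc]) measurable
    also have "\<dots> = (\<integral>\<^sup>+u. \<integral>\<^sup>+z. ennreal (sink_weight i u) / H * (ennreal (weight B z) / Z) * indicator S (u, z) \<partial>?MB \<partial>lborel)"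
      using fins by (simp add: divide_ennreal_def ennreal_inverse_mult ac_simps)
    also have "\<dots> = (\<integral>\<^sup>+p. (case p of (u, z) \<Rightarrow> ennreal (sink_weight i u) / H * (ennreal (weight B z) / Z)) * indicator S p \<partial>(lborel \<Otimes>\<^sub>M ?MB))"
      by (subst lB.nn_integral_fst[symmetric]) (use fin in \<open>auto simp: case_prod_beta\<close>)
    also have "\<dots> = emeasure (sink_prior i \<Otimes>\<^sub>M prior B) S"
      unfolding dens by (subst emeasure_density) (use fin S in auto)
    finally show "emeasure (distr (prior (insert i B)) (borel \<Otimes>\<^sub>M ?MB) ?X) S = emeasure (sink_prior i \<Otimes>\<^sub>M prior B) S" .
  qed
qed

end


section \<open>Independence\<close>

text \<open>
  The two arguments of \<open>indep_var\<close> share their value type, which a sink variable and a vector do not;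
  hence the functions \<open>F\<close> and \<open>G\<close>.
\<close>
lemma independence_of_product_law:
  assumes M: "prob_space M" and N: "prob_space N1" "prob_space N2"
    and X [measurable]: "X \<in> measurable M N1" and Y [measurable]: "Y \<in> measurable M N2"
    and pair: "distr M (N1 \<Otimes>\<^sub>M N2) (\<lambda>x. (X x, Y x)) = N1 \<Otimes>\<^sub>M N2"
  shows "distr M N2 Y = N2"
    and "F \<in> measurable N1 S \<Longrightarrow> G \<in> measurable N2 T \<Longrightarrow> prob_space.indep_var M S (F \<circ> X) T (G \<circ> Y)"
proof -
  interpret M: prob_space M by fact
  interpret N1: prob_space N1 by fact
  interpret N2: prob_space N2 by fact
  have "distr M N1 X = distr (distr M (N1 \<Otimes>\<^sub>M N2) (\<lambda>x. (X x, Y x))) N1 fst"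
    by (subst distr_distr) (auto simp: comp_def)
  then have X1: "distr M N1 X = N1"
    by (simp add: pair N2.distr_pair_fst)
  have "distr M N2 Y = distr (distr M (N1 \<Otimes>\<^sub>M N2) (\<lambda>x. (X x, Y x))) N2 snd"
    by (subst distr_distr) (auto simp: comp_def)
  also have "\<dots> = N2"
    unfolding pair
  proof (rule measure_eqI)
    fix A assume "A \<in> sets (distr (N1 \<Otimes>\<^sub>M N2) N2 snd)"
    then have A: "A \<in> sets N2" by simp
    then have "snd -` A \<inter> space (N1 \<Otimes>\<^sub>M N2) = space N1 \<times> A"
      using sets.sets_into_space by (fastforce simp: space_pair_measure)
    then show "emeasure (distr (N1 \<Otimes>\<^sub>M N2) N2 snd) A = emeasure N2 A"
      using A by (simp add: emeasure_distr N2.emeasure_pair_measure_Times N1.emeasure_space_1)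
  qed simp
  finally show Y2: "distr M N2 Y = N2" .
  assume F [measurable]: "F \<in> measurable N1 S" and G [measurable]: "G \<in> measurable N2 T"
  have "distr M S (F \<circ> X) \<Otimes>\<^sub>M distr M T (G \<circ> Y) = distr N1 S F \<Otimes>\<^sub>M distr N2 T G"
    using distr_distr[OF F X] distr_distr[OF G Y] by (simp add: X1 Y2)
  also have "\<dots> = distr (N1 \<Otimes>\<^sub>M N2) (S \<Otimes>\<^sub>M T) (\<lambda>(x, y). (F x, G y))"
    by (intro pair_measure_distr F G prob_space_imp_sigma_finite N2.prob_space_distr)
  also have "\<dots> = distr M (S \<Otimes>\<^sub>M T) (\<lambda>x. ((F \<circ> X) x, (G \<circ> Y) x))"
    by (subst pair[symmetric], subst distr_distr) (auto simp: comp_def)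
  finally show "M.indep_var S (F \<circ> X) T (G \<circ> Y)"
    unfolding M.indep_var_distribution_eq using measurable_comp[OF X F] measurable_comp[OF Y G] by simp
qed

lemma indep_var_cong_AE:
  assumes "prob_space M" "prob_space.indep_var M S X T Y"
    and "X' \<in> measurable M S" "Y' \<in> measurable M T" "AE x in M. X' x = X x" "AE x in M. Y' x = Y x"
  shows "prob_space.indep_var M S X' T Y'"
proof -
  interpret prob_space M by fact
  have rv: "X \<in> measurable M S" "Y \<in> measurable M T"
    and eq: "distr M S X \<Otimes>\<^sub>M distr M T Y = distr M (S \<Otimes>\<^sub>M T) (\<lambda>x. (X x, Y x))"
    using assms(2) unfolding indep_var_distribution_eq by auto
  have "distr M S X' = distr M S X" "distr M T Y' = distr M T Y"
    using assms(3-) rv by (auto intro: distr_cong_AE)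
  moreover have "distr M (S \<Otimes>\<^sub>M T) (\<lambda>x. (X' x, Y' x)) = distr M (S \<Otimes>\<^sub>M T) (\<lambda>x. (X x, Y x))"
    using assms(3-) rv by (intro distr_cong_AE) auto
  ultimately show ?thesis
    unfolding indep_var_distribution_eq using assms(3,4) eq by simp
qed

context graph_model
begin

lemma marginal_law_measurable:
  assumes "finite A"
  shows "(\<lambda>x. marginal_prob (law A x) S n) \<in> borel_measurable (\<Pi>\<^sub>M j\<in>A. lborel)"
proof -
  let ?C = "A \<rightarrow>\<^sub>E (UNIV :: nat set)" and ?X = "{m \<in> A \<rightarrow>\<^sub>E UNIV. restrict m S = restrict n S}"
  let ?M = "\<Pi>\<^sub>M j\<in>A. (lborel :: real measure)"
  have cnt: "countable ?C" using assms by (intro countable_PiE) auto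
  interpret C: sigma_finite_measure "count_space ?C"
    using cnt by (rule sigma_finite_measure_count_space_countable)
  have comp [measurable]: "(\<lambda>x. x j) \<in> borel_measurable ?M" if "j \<in> A" for j
    using measurable_component_singleton[of j A "\<lambda>_. lborel", OF that] by simp
  have mass: "(\<lambda>x. mass A x m) \<in> borel_measurable ?M" for m
  proof -
    have "(\<lambda>x. \<Prod>i\<in>A. x i ^ m i) \<in> borel_measurable ?M"
      by (intro borel_measurable_prod borel_measurable_power comp)
    moreover have "(\<lambda>x. pw (P A x)) \<in> borel_measurable ?M"
      by (rule measurable_compose[OF stable_poly_measurable[OF assms subset_refl] pw_measurable])
    ultimately show ?thesis unfolding mass_def by measurable
  qed
  have "(\<lambda>(m, x). ennreal (mass A x m) * indicator ?X m) \<in> borel_measurable (count_space ?C \<Otimes>\<^sub>M ?M)"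
    using mass by (intro measurable_pair_measure_countable1 cnt) auto
  from measurable_compose[OF measurable_pair_swap' this]
  have "(\<lambda>(x, m). ennreal (mass A x m) * indicator ?X m) \<in> borel_measurable (?M \<Otimes>\<^sub>M count_space ?C)"
    by (simp add: case_prod_beta)
  then have "(\<lambda>x. \<integral>\<^sup>+m. ennreal (mass A x m) * indicator ?X m \<partial>count_space ?C) \<in> borel_measurable ?M"
    by (rule C.borel_measurable_nn_integral)
  moreover have "emeasure (law A x) ?X = (\<integral>\<^sup>+m. ennreal (mass A x m) * indicator ?X m \<partial>count_space ?C)" for x
    unfolding law_def by (subst emeasure_density) auto
  ultimately show ?thesis
    unfolding marginal_prob_def space_law measure_def by simp
qed

lemma bayesian_model_prior_law: "bayesian_model (params s V) (prior V) (law V)"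
  using prob_space_prior[OF ancestral_V] AE_prior[OF finite_V] prob_space_law[OF ancestral_V]
  by (auto simp: bayesian_model_def)

lemma distr_prior_sink:
  assumes anc: "ancestral B" "ancestral (insert i B)" "i \<notin> B"
  shows "(\<lambda>x. x i) \<in> prior (insert i B) \<rightarrow>\<^sub>M sink_prior i"
    and "eliminate s i B \<in> prior (insert i B) \<rightarrow>\<^sub>M prior B"
    and "distr (prior (insert i B)) (sink_prior i \<Otimes>\<^sub>M prior B) (\<lambda>x. (x i, eliminate s i B x)) =
      sink_prior i \<Otimes>\<^sub>M prior B"
proof -
  show "(\<lambda>x. x i) \<in> prior (insert i B) \<rightarrow>\<^sub>M sink_prior i"
    using measurable_component_singleton[of i "insert i B" "\<lambda>_. lborel"]
    unfolding measurable_cong_sets[OF sets_prior sets_sink_prior] by simp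
  show "eliminate s i B \<in> prior (insert i B) \<rightarrow>\<^sub>M prior B"
    using eliminate_measurable[OF anc(2,3)] unfolding measurable_cong_sets[OF sets_prior sets_prior] .
  have "sets (borel \<Otimes>\<^sub>M (\<Pi>\<^sub>M j\<in>B. lborel)) = sets (sink_prior i \<Otimes>\<^sub>M prior B)"
    by (intro sets_pair_measure_cong) (simp_all add: sets_prior sets_sink_prior)
  then have "distr (prior (insert i B)) (sink_prior i \<Otimes>\<^sub>M prior B) (\<lambda>x. (x i, eliminate s i B x)) =
      distr (prior (insert i B)) (borel \<Otimes>\<^sub>M (\<Pi>\<^sub>M j\<in>B. lborel)) (\<lambda>x. (x i, eliminate s i B x))"
    by (intro distr_cong) auto
  then show "distr (prior (insert i B)) (sink_prior i \<Otimes>\<^sub>M prior B) (\<lambda>x. (x i, eliminate s i B x)) =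
      sink_prior i \<Otimes>\<^sub>M prior B"
    using distr_prior_eliminate[OF anc] by simp
qed

text \<open>
  The map \<open>T\<close> eliminates the vertices outside \<open>A\<close>, each at a time when it is a sink.
\<close>
lemma reduction_to_ancestral:
  assumes "ancestral A"
  shows "\<exists>T. T \<in> prior V \<rightarrow>\<^sub>M prior A \<and> distr (prior V) (prior A) T = prior A \<and>
    (\<forall>x\<in>params s V. T x \<in> params s A \<and>
      (\<forall>S n. S \<subseteq> A \<longrightarrow> marginal_prob (law V x) S n = marginal_prob (law A (T x)) S n))"
proof -
  have "A \<subseteq> V" using assms by (auto simp: ancestral_def)
  with assms ancestral_V show ?thesis
  proof (induction rule: ancestral_induct)
    case base
    show ?case by (rule exI[of _ "\<lambda>x. x"]) (simp add: distr_id2)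
  next
    case (sink i B)
    note anc = sink(1,2,4)
    obtain T where T: "T \<in> prior B \<rightarrow>\<^sub>M prior A" "distr (prior B) (prior A) T = prior A"
      and TP: "\<And>x. x \<in> params s B \<Longrightarrow> T x \<in> params s A"
      and TM: "\<And>x S n. x \<in> params s B \<Longrightarrow> S \<subseteq> A \<Longrightarrow> marginal_prob (law B x) S n = marginal_prob (law A (T x)) S n"
      using sink.IH by blast
    have "i \<in> V" using anc by (auto simp: ancestral_def)
    note pb = distr_prior_sink[OF anc]
    have "distr (prior (insert i B)) (prior B) (eliminate s i B) = prior B"
      by (rule independence_of_product_law(1)) (fact prob_space_prior[OF anc(2)]
            prob_space_sink_prior[OF \<open>i \<in> V\<close>] prob_space_prior[OF anc(1)] pb)+
    then have "distr (prior (insert i B)) (prior A) (T \<circ> eliminate s i B) = prior A"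
      using distr_distr[OF T(1) pb(2)] T(2) by simp
    moreover have "T \<circ> eliminate s i B \<in> prior (insert i B) \<rightarrow>\<^sub>M prior A"
      using pb(2) T(1) by (rule measurable_comp)
    moreover have "(T \<circ> eliminate s i B) x \<in> params s A \<and>
        (\<forall>S n. S \<subseteq> A \<longrightarrow> marginal_prob (law (insert i B) x) S n = marginal_prob (law A ((T \<circ> eliminate s i B) x)) S n)"
      if x: "x \<in> params s (insert i B)" for x
    proof -
      have "eliminate s i B x \<in> params s B"
        using params_insert_iff[OF anc s_cases, of x] x by (auto simp: params_def PiE_def)
      moreover have "marginal_prob (law (insert i B) x) S n = marginal_prob (law B (eliminate s i B x)) S n"
        if "S \<subseteq> A" for S n
        using that sink(3) by (intro marginal_law_eliminate[OF anc x]) auto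
      ultimately show ?thesis using TP TM by auto
    qed
    ultimately show ?case by blast
  qed
qed

lemma ancestral_nondescendants:
  assumes "i \<in> V"
  shows "ancestral (nondescendants V D i)" "ancestral (insert i (nondescendants V D i))"
    "i \<notin> nondescendants V D i"
proof -
  have par: "parents D j \<subseteq> nondescendants V D i" if j: "j \<in> insert i (nondescendants V D i)" for j
  proof
    fix k assume "k \<in> parents D j"
    then have kj: "(k, j) \<in> D" and "k \<in> V" using parents_V by (auto simp: parents_def)
    have no_path: "(i, j) \<notin> D\<^sup>+"
      using j acyclic_D by (auto simp: nondescendants_def descendants_def acyclic_def)
    then have "(i, k) \<notin> D\<^sup>+" using kj by (meson trancl_into_trancl)
    moreover have "k \<noteq> i" using no_path kj by auto
    ultimately show "k \<in> nondescendants V D i"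
      using \<open>k \<in> V\<close> by (auto simp: nondescendants_def descendants_def)
  qed
  have sub: "nondescendants V D i \<subseteq> V" by (auto simp: nondescendants_def)
  show "ancestral (nondescendants V D i)" "ancestral (insert i (nondescendants V D i))"
    using par sub assms by (auto simp: ancestral_def)
  show "i \<notin> nondescendants V D i" by (simp add: nondescendants_def)
qed

lemma strong_directed_hyper_Markov_prior_law:
  "strong_directed_hyper_Markov V D (params s V) (prior V) (law V)"
  unfolding strong_directed_hyper_Markov_def
proof
  fix i assume i: "i \<in> V"
  define N where "N = nondescendants V D i"
  define Q where "Q = parents D i"
  let ?A = "insert i N"
  let ?J = "p_cond_index (params s V) (law V) {i} Q"
  note anc = ancestral_nondescendants[OF i, folded N_def]
  have QN: "Q \<subseteq> N" unfolding Q_def by (rule sink_parents) fact+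
  obtain T where T: "T \<in> prior V \<rightarrow>\<^sub>M prior ?A" "distr (prior V) (prior ?A) T = prior ?A"
    and TP: "\<And>x. x \<in> params s V \<Longrightarrow> T x \<in> params s ?A"
    and TM: "\<And>x S n. x \<in> params s V \<Longrightarrow> S \<subseteq> ?A \<Longrightarrow> marginal_prob (law V x) S n = marginal_prob (law ?A (T x)) S n"
    using reduction_to_ancestral[OF anc(2)] by blast
  let ?U = "\<lambda>x. T x i" and ?W = "\<lambda>x. eliminate s i N (T x)"
  note pb = distr_prior_sink[OF anc]
  have U: "?U \<in> prior V \<rightarrow>\<^sub>M sink_prior i" and W: "?W \<in> prior V \<rightarrow>\<^sub>M prior N"
    using measurable_compose[OF T(1) pb(1)] measurable_compose[OF T(1) pb(2)] by simp_all
  have "distr (prior V) (sink_prior i \<Otimes>\<^sub>M prior N) (\<lambda>x. (?U x, ?W x)) =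
      distr (distr (prior V) (prior ?A) T) (sink_prior i \<Otimes>\<^sub>M prior N) (\<lambda>x. (x i, eliminate s i N x))"
    using T(1) pb(1,2) by (subst distr_distr) (auto simp: comp_def)
  also have "\<dots> = sink_prior i \<Otimes>\<^sub>M prior N"
    unfolding T(2) by (rule pb(3))
  finally have pair: "distr (prior V) (sink_prior i \<Otimes>\<^sub>M prior N) (\<lambda>x. (?U x, ?W x)) = sink_prior i \<Otimes>\<^sub>M prior N" .
  \<comment> \<open>\<open>F\<close> and \<open>G\<close> express the two families through the independent components.\<close>
  define F where "F u = (\<lambda>n\<in>?J. max 0 (cond_mass u (\<Sum>j\<in>Q. n j) (n i)))" for u
  define G where "G z = (\<lambda>n\<in>p_marg_index N. marginal_prob (law N z) N n)" for z
  have "F \<in> borel \<rightarrow>\<^sub>M (\<Pi>\<^sub>M n\<in>?J. borel)"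
    unfolding F_def[abs_def] cond_mass_def by (rule measurable_restrict) measurable
  then have F: "F \<in> sink_prior i \<rightarrow>\<^sub>M (\<Pi>\<^sub>M n\<in>?J. borel)"
    unfolding measurable_cong_sets[OF sets_sink_prior refl] .
  have "G \<in> (\<Pi>\<^sub>M j\<in>N. lborel) \<rightarrow>\<^sub>M (\<Pi>\<^sub>M n\<in>p_marg_index N. borel)"
    unfolding G_def[abs_def] by (intro measurable_restrict marginal_law_measurable ancestral_finite anc)
  then have G: "G \<in> prior N \<rightarrow>\<^sub>M (\<Pi>\<^sub>M n\<in>p_marg_index N. borel)"
    unfolding measurable_cong_sets[OF sets_prior refl] .
  have indep: "prob_space.indep_var (prior V) (\<Pi>\<^sub>M n\<in>?J. borel) (F \<circ> ?U) (\<Pi>\<^sub>M n\<in>p_marg_index N. borel) (G \<circ> ?W)"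
    by (rule independence_of_product_law(2)[OF prob_space_prior[OF ancestral_V] prob_space_sink_prior[OF i]
        prob_space_prior[OF anc(1)] U W pair F G])
  have marg: "(\<lambda>x. marginal_prob (law V x) S n) \<in> borel_measurable (prior V)" for S n
    using marginal_law_measurable[OF finite_V] unfolding measurable_cong_sets[OF sets_prior refl] .
  show "prob_space.indep_var (prior V)
      (\<Pi>\<^sub>M n\<in>p_cond_index (params s V) (law V) {i} (parents D i). borel)
      (p_cond (params s V) (law V) {i} (parents D i))
      (\<Pi>\<^sub>M n\<in>p_marg_index (nondescendants V D i). borel) (p_marg (law V) (nondescendants V D i))"
    unfolding Q_def[symmetric] N_def[symmetric]
  proof (rule indep_var_cong_AE[OF prob_space_prior[OF ancestral_V] indep])
    show "p_cond (params s V) (law V) {i} Q \<in> prior V \<rightarrow>\<^sub>M (\<Pi>\<^sub>M n\<in>?J. borel)"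
      unfolding p_cond_def[abs_def] by (intro measurable_restrict borel_measurable_divide marg)
    show "p_marg (law V) N \<in> prior V \<rightarrow>\<^sub>M (\<Pi>\<^sub>M n\<in>p_marg_index N. borel)"
      unfolding p_marg_def[abs_def] by (intro measurable_restrict marg)
    have cond: "p_cond (params s V) (law V) {i} Q x = (F \<circ> ?U) x" if x: "x \<in> params s V" for x
    proof -
      have "marginal_prob (law V x) (Q \<union> {i}) n / marginal_prob (law V x) Q n =
          max 0 (cond_mass (T x i) (\<Sum>j\<in>Q. n j) (n i))" if n: "n \<in> ?J" for n
      proof -
        obtain y where "y \<in> params s V" "marginal_prob (law V y) Q n \<noteq> 0"
          using n by (auto simp: p_cond_index_def)
        then have nz: "marginal_prob (law V x) Q n \<noteq> 0"
          using marginal_law_nonzero[OF ancestral_V _ x] by blast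
        have QA: "Q \<subseteq> ?A" "Q \<union> {i} \<subseteq> ?A" using QN by auto
        have "marginal_prob (law ?A (T x)) Q n \<noteq> 0"
          using nz TM[OF x QA(1)] by simp
        then show ?thesis
          unfolding TM[OF x QA(1)] TM[OF x QA(2)] unfolding Q_def by (rule marginal_law_family[OF anc TP[OF x]])
      qed
      then show ?thesis by (auto simp: p_cond_def F_def)
    qed
    have marg_eq: "p_marg (law V) N x = (G \<circ> ?W) x" if x: "x \<in> params s V" for x
      using TM[OF x subset_insertI[of N i]] marginal_law_eliminate[OF anc TP[OF x] subset_refl]
      by (auto simp: p_marg_def G_def)
    \<comment> \<open>The probabilities are given by the law of the reduced parameter only where \<open>x\<close> is admissible.\<close>
    show "AE x in prior V. p_cond (params s V) (law V) {i} Q x = (F \<circ> ?U) x"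
      using AE_prior[OF finite_V] by eventually_elim (rule cond)
    show "AE x in prior V. p_marg (law V) N x = (G \<circ> ?W) x"
      using AE_prior[OF finite_V] by eventually_elim (rule marg_eq)
  qed
qed

end

theorem corollary7p3:
  fixes V :: "'a set" and E D :: "'a rel"
  assumes "finite_simple_graph V E"
    and "decomposable V E"
    and "moral_DAG E D"
  shows "(\<forall>(r::real) (\<alpha>::'a \<Rightarrow> real) (\<beta>::real).
            r > 0 \<and> (\<forall>i\<in>V. \<alpha> i > 0) \<and> \<beta> > 0 \<longrightarrow>
            bayesian_model (M_set V E) (Dir V E \<alpha> \<beta>) (nm V E r) \<and>
            strong_directed_hyper_Markov V D (M_set V E) (Dir V E \<alpha> \<beta>) (nm V E r))
       \<and> (\<forall>(r::nat) (\<alpha>::'a \<Rightarrow> real) (\<beta>::real).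
            r \<ge> 1 \<and> (\<forall>i\<in>V. \<alpha> i > 0) \<and> \<beta> > Max ((\<lambda>C. \<Sum>i\<in>C. \<alpha> i) ` max_cliques V E) \<longrightarrow>
            bayesian_model (V \<rightarrow>\<^sub>E {0<..}) (IDir V E \<alpha> \<beta>) (multinomial V E r) \<and>
            strong_directed_hyper_Markov V D (V \<rightarrow>\<^sub>E {0<..}) (IDir V E \<alpha> \<beta>) (multinomial V E r))"
proof (intro conjI allI impI; elim conjE)
  interpret moral_graph V E D by unfold_locales fact+
  fix r \<beta> :: real and \<alpha> :: "'a \<Rightarrow> real"
  assume r: "r > 0" "\<forall>i\<in>V. \<alpha> i > 0" "\<beta> > 0"
  interpret graph_model V E D "- 1" "- r" "\<beta> - 1" \<alpha> "\<lambda>t. t powr r"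
    by unfold_locales (use r in auto)
  have "M_set V E = params (- 1) V"
    by (simp add: M_set_def params_def Delta_def stable_poly_def cliques_complement_induced irrefl_E)
  moreover from this have "Dir V E \<alpha> \<beta> = prior V"
    by (simp add: Dir_def prior_def weight_def[abs_def] Delta_eq)
  moreover have "nm V E r = law V"
    by (simp add: fun_eq_iff nm_def law_def mass_def nm_coeff_eq Delta_eq)
  ultimately show "bayesian_model (M_set V E) (Dir V E \<alpha> \<beta>) (nm V E r)"
    and "strong_directed_hyper_Markov V D (M_set V E) (Dir V E \<alpha> \<beta>) (nm V E r)"
    using bayesian_model_prior_law strong_directed_hyper_Markov_prior_law by simp_all
next
  interpret moral_graph V E D by unfold_locales fact+
  fix r :: nat and \<beta> :: real and \<alpha> :: "'a \<Rightarrow> real"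
  assume r: "r \<ge> 1" "\<forall>i\<in>V. \<alpha> i > 0" "\<beta> > Max ((\<lambda>C. \<Sum>i\<in>C. \<alpha> i) ` max_cliques V E)"
  have "(\<Sum>i\<in>C. \<alpha> i) < \<beta>" if "C \<in> cliques V E" for C
    using clique_sum_less[OF _ r(3) that] r(2) by (auto intro: less_imp_le)
  then interpret graph_model V E D 1 "real r" "- \<beta>" \<alpha> "\<lambda>t. 1 / t ^ r"
    by unfold_locales (use r in \<open>auto simp: powr_minus_divide powr_realpow\<close>)
  have "V \<rightarrow>\<^sub>E {0<..} = params 1 V"
    using finite_subset[OF _ finite_V] by (auto simp: params_def PiE_def Pi_def intro!: stable_poly_pos)
  moreover from this have "IDir V E \<alpha> \<beta> = prior V"
    by (simp add: IDir_def prior_def weight_def[abs_def] delta_eq)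
  moreover have "multinomial V E r = law V"
    unfolding multinomial_def law_def
  proof (intro ext density_cong)
    fix x :: "'a \<Rightarrow> real"
    have "ennreal (mult_coeff V E r n * (\<Prod>i\<in>V. x i ^ n i) / delta V E x ^ r * indicator (mult_support V E r) n) =
        ennreal (mass V x n)" if "n \<in> V \<rightarrow>\<^sub>E UNIV" for n
      using mult_coeff_support[OF that, of r]
      by (cases "mult_coeff V E r n = 0") (auto simp: mass_def mult_coeff_eq delta_eq)
    then show "AE n in count_space (V \<rightarrow>\<^sub>E UNIV). ennreal (mult_coeff V E r n * (\<Prod>i\<in>V. x i ^ n i) /
        delta V E x ^ r * indicator (mult_support V E r) n) = ennreal (mass V x n)"
      by (simp add: AE_count_space)
  qed auto
  ultimately show "bayesian_model (V \<rightarrow>\<^sub>E {0<..}) (IDir V E \<alpha> \<beta>) (multinomial V E r)"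
    and "strong_directed_hyper_Markov V D (V \<rightarrow>\<^sub>E {0<..}) (IDir V E \<alpha> \<beta>) (multinomial V E r)"
    using bayesian_model_prior_law strong_directed_hyper_Markov_prior_law by simp_all
qed

end
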